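(* Let $n\ge 1$ be an integer, $\kappa>0$, let $C\subset\mathbb{H}^n_\kappa$ be a closed $\kappa$-hyperbolically convex set and $f:\mathbb{H}^n_\kappa\to\mathbb{R}$ a differentiable function such that the problem of minimizing $f$ over $C$ has a nonempty solution set, with optimum value $f^*:=\inf_{p\in C}f(p)>-\infty$. Let $(p_k)_{k\in\mathbb{N}}$ be the sequence generated by the gradient projection method with backtracking step size rule (described in the context) applied to $f$ and $C$, with $\operatorname{grad} f(p_k)\neq 0$ for all $k=0,1,\ldots$. If $\bar p\in C$ is a cluster point of the sequence $(p_k)_{k\in\mathbb{N}}$, then $\bar p$ is a stationary point of the problem of minimizing $f$ over $C$.
   Context: Here $\mathbb{N}=\{0,1,2,\ldots\}$. For $x,y\in\mathbb{R}^{n+1}$ the Lorentzian inner product is $\langle x,y\rangle:=x_1y_1+\dots+x_ny_n-x_{n+1}y_{n+1}$. The $\kappa$-hyperbolic space form is $\mathbb{H}^n_\kappa:=\{p\in\mathbb{R}^{n+1}:\langle p,p\rangle=-1/\kappa,\ p_{n+1}>0\}$, with tangent space $T_p\mathbb{H}^n_\kappa:=\{v\in\mathbb{R}^{n+1}:\langle p,v\rangle=0\}$, on which $\langle\cdot,\cdot\rangle$ is positive definite (a Riemannian metric), with norm $\|v\|=\sqrt{\langle v,v\rangle}$. The intrinsic distance is $d_\kappa(p,q):=\frac{1}{\sqrt\kappa}\operatorname{arcosh}(-\kappa\langle p,q\rangle)$. Exponential map: $\exp^\kappa_p(0)=p$ and $\exp^\kappa_p(v)=\cosh(\sqrt\kappa\|v\|)\,p+\sinh(\sqrt\kappa\|v\|)\frac{v}{\sqrt\kappa\|v\|}$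 for $0\ne v\in T_p\mathbb{H}^n_\kappa$. Its inverse is $\log^\kappa_p p=0$ and $\log^\kappa_p q=d_\kappa(p,q)\frac{q+\kappa\langle p,q\rangle p}{\|q+\kappa\langle p,q\rangle p\|}$ for $q\ne p$. The geodesic segment joining $p$ to $q$ is $\{\exp^\kappa_p(t\log^\kappa_p q):t\in[0,1]\}$. A set $C\subseteq\mathbb{H}^n_\kappa$ is $\kappa$-hyperbolically convex if for all $p,q\in C$ the geodesic segment joining $p$ to $q$ is contained in $C$. For a nonempty closed $\kappa$-hyperbolically convex set $C$, the intrinsic $\kappa$-projection $P^\kappa_C(p)$ of $p\in\mathbb{H}^n_\kappa$ is the unique minimizer of $q\mapsto d_\kappa(p,q)$ over $q\in C$. $\operatorname{grad} f(p)\in T_p\mathbb{H}^n_\kappa$ is the Riemannian gradient: $df(p)v=\langle\operatorname{grad} f(p),v\rangle$ for all $v\in T_p\mathbb{H}^n_\kappa$. A point $\bar p\in C$ is stationary for minimizing $f$ over $C$ if $\langle\operatorname{grad} f(\bar p),p\rangle\ge 0$ for all $p\in C$. A cluster point of a sequence is a limit of some subsequence. Gradient projection method with backtracking step size rule: take constants $\rho,\beta,\theta_0\in(0,1)$ and $\hat\alpha,\bar\alpha>0$, and choose an initial point $p_0\in C$. For $k=0,1,2,\dots$: if $\operatorname{grad} f(p_k)=0$, stop and return $p_k$; otherwise take $\alpha_k$ with $0<\hat\alpha\le\alpha_k\le\bar\alpha$; compute $y_k:=\exp^\kappa_{p_k}(-\alpha_k\operatorname{grad} f(p_k))$, $z_k:=P^\kappa_C(y_k)$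 and $$\ell_k:=\min\big\{\ell\in\mathbb{N}: f(q(\beta^\ell\theta_k))\le f(p_k)+\rho\,(\beta^\ell\theta_k)\langle\operatorname{grad} f(p_k),\log^\kappa_{p_k}z_k\rangle\big\},$$ where $q(\tau):=\exp^\kappa_{p_k}(\tau\log^\kappa_{p_k}z_k)$ denotes the geodesic segment joining $p_k$ to $z_k$; set $p_{k+1}:=q(\beta^{\ell_k}\theta_k)$ and $\theta_{k+1}:=\beta^{\ell_k-1}\theta_k$.
   Formalization: The function f is assumed continuously differentiable (grad f continuous on the hyperbolic space), and the line search only tries parameters β^ℓ θ_k in [0,1], so trial points lie on the geodesic segment from p_k to z_k; without either condition the claim is false. *)

theory Defs
  imports "HOL-Analysis.Analysis"
begin

text \<open>
  The ambient space of dimension \<open>n + 1\<close> is rendered as \<^typ>\<open>(real^'n) \<times> real\<close>, with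
  \<open>n = CARD('n) \<ge> 1\<close>; the second component is the last, time-like coordinate.
\<close>

definition lorentz :: "(real^'n) \<times> real \<Rightarrow> (real^'n) \<times> real \<Rightarrow> real" where
  "lorentz x y = (\<Sum>i\<in>UNIV. fst x $ i * fst y $ i) - snd x * snd y"

definition hyp_space :: "real \<Rightarrow> ((real^'n) \<times> real) set" where
  "hyp_space \<kappa> = {p. lorentz p p = - 1 / \<kappa> \<and> snd p > 0}"

definition hyp_tangent :: "(real^'n) \<times> real \<Rightarrow> ((real^'n) \<times> real) set" where
  "hyp_tangent p = {v. lorentz p v = 0}"

definition lnorm :: "(real^'n) \<times> real \<Rightarrow> real" where
  "lnorm v = sqrt (lorentz v v)"

definition hyp_dist :: "real \<Rightarrow> (real^'n) \<times> real \<Rightarrow> (real^'n) \<times> real \<Rightarrow> real" where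
  "hyp_dist \<kappa> p q = 1 / sqrt \<kappa> * arcosh (- \<kappa> * lorentz p q)"

definition hyp_exp ::
    "real \<Rightarrow> (real^'n) \<times> real \<Rightarrow> (real^'n) \<times> real \<Rightarrow> (real^'n) \<times> real" where
  "hyp_exp \<kappa> p v =
    (if v = 0 then p
     else cosh (sqrt \<kappa> * lnorm v) *\<^sub>R p
        + sinh (sqrt \<kappa> * lnorm v) *\<^sub>R (v /\<^sub>R (sqrt \<kappa> * lnorm v)))"

definition hyp_log ::
    "real \<Rightarrow> (real^'n) \<times> real \<Rightarrow> (real^'n) \<times> real \<Rightarrow> (real^'n) \<times> real" where
  "hyp_log \<kappa> p q =
    (if q = p then 0
     else (let w = q + (\<kappa> * lorentz p q) *\<^sub>R p in hyp_dist \<kappa> p q *\<^sub>R (w /\<^sub>R lnorm w)))"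

definition hyp_geodesic ::
    "real \<Rightarrow> (real^'n) \<times> real \<Rightarrow> (real^'n) \<times> real \<Rightarrow> real \<Rightarrow> (real^'n) \<times> real" where
  "hyp_geodesic \<kappa> p q t = hyp_exp \<kappa> p (t *\<^sub>R hyp_log \<kappa> p q)"

definition hyp_segment ::
    "real \<Rightarrow> (real^'n) \<times> real \<Rightarrow> (real^'n) \<times> real \<Rightarrow> ((real^'n) \<times> real) set" where
  "hyp_segment \<kappa> p q = hyp_geodesic \<kappa> p q ` {0..1}"

definition hyp_convex :: "real \<Rightarrow> ((real^'n) \<times> real) set \<Rightarrow> bool" where
  "hyp_convex \<kappa> C \<longleftrightarrow> (\<forall>p\<in>C. \<forall>q\<in>C. hyp_segment \<kappa> p q \<subseteq> C)"

definition hyp_proj ::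
    "real \<Rightarrow> ((real^'n) \<times> real) set \<Rightarrow> (real^'n) \<times> real \<Rightarrow> (real^'n) \<times> real" where
  "hyp_proj \<kappa> C p = (THE q. is_arg_min (hyp_dist \<kappa> p) (\<lambda>q. q \<in> C) q)"

text \<open>
  The differential \<open>df(p)\<close> is the derivative of \<open>f\<close> at \<open>p\<close> within the hyperboloid, so only the
  values of \<open>f\<close> on the hyperboloid matter. The within-derivative is unique only on the tangent
  space at \<open>p\<close>, which is the only place where it is used.
\<close>

definition hyp_grad ::
    "real \<Rightarrow> ((real^'n) \<times> real \<Rightarrow> real) \<Rightarrow> (real^'n) \<times> real \<Rightarrow> (real^'n) \<times> real" where
  "hyp_grad \<kappa> f p =
    (THE g. g \<in> hyp_tangent p \<and>
       (\<forall>v\<in>hyp_tangent p. frechet_derivative f (at p within hyp_space \<kappa>) v = lorentz g v))"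

definition hyp_stationary ::
    "real \<Rightarrow> ((real^'n) \<times> real \<Rightarrow> real) \<Rightarrow> ((real^'n) \<times> real) set \<Rightarrow> (real^'n) \<times> real \<Rightarrow> bool" where
  "hyp_stationary \<kappa> f C pbar \<longleftrightarrow>
     pbar \<in> C \<and> (\<forall>p\<in>C. lorentz (hyp_grad \<kappa> f pbar) p \<ge> 0)"

definition cluster_point :: "(nat \<Rightarrow> 'a::topological_space) \<Rightarrow> 'a \<Rightarrow> bool" where
  "cluster_point X l \<longleftrightarrow> (\<exists>r. strict_mono r \<and> (X \<circ> r) \<longlonglongrightarrow> l)"

text \<open>
  In the line search the trial points are taken on the geodesic segment from \<open>p k\<close> to \<open>z k\<close>, that
  is, with parameter in \<open>[0,1]\<close>. The requirement is not void: \<open>\<theta> k\<close> may exceed 1, because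
  \<open>\<theta> (Suc k) = \<theta> k / \<beta>\<close> whenever \<open>L k = 0\<close>. No step is prescribed once the gradient vanishes.
\<close>

definition gradient_projection_backtracking ::
    "real \<Rightarrow> ((real^'n) \<times> real \<Rightarrow> real) \<Rightarrow> ((real^'n) \<times> real) set \<Rightarrow>
     real \<Rightarrow> real \<Rightarrow> real \<Rightarrow> real \<Rightarrow> real \<Rightarrow>
     (nat \<Rightarrow> real) \<Rightarrow> (nat \<Rightarrow> real) \<Rightarrow> (nat \<Rightarrow> nat) \<Rightarrow>
     (nat \<Rightarrow> (real^'n) \<times> real) \<Rightarrow> (nat \<Rightarrow> (real^'n) \<times> real) \<Rightarrow> (nat \<Rightarrow> (real^'n) \<times> real) \<Rightarrow> bool" where
  "gradient_projection_backtracking \<kappa> f C \<rho> \<beta> \<theta>0 \<alpha>lo \<alpha>hi \<alpha> \<theta> L y z p \<longleftrightarrow>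
     p 0 \<in> C \<and> \<theta> 0 = \<theta>0 \<and>
     (\<forall>k. hyp_grad \<kappa> f (p k) \<noteq> 0 \<longrightarrow>
        \<alpha>lo \<le> \<alpha> k \<and> \<alpha> k \<le> \<alpha>hi \<and>
        y k = hyp_exp \<kappa> (p k) (- \<alpha> k *\<^sub>R hyp_grad \<kappa> f (p k)) \<and>
        z k = hyp_proj \<kappa> C (y k) \<and>
        L k = (LEAST l. \<beta> ^ l * \<theta> k \<in> {0..1} \<and>
                 f (hyp_geodesic \<kappa> (p k) (z k) (\<beta> ^ l * \<theta> k))
                   \<le> f (p k) + \<rho> * (\<beta> ^ l * \<theta> k)
                       * lorentz (hyp_grad \<kappa> f (p k)) (hyp_log \<kappa> (p k) (z k))) \<and>
        p (Suc k) = hyp_geodesic \<kappa> (p k) (z k) (\<beta> ^ L k * \<theta> k) \<and>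
        \<theta> (Suc k) = \<beta> powi (int (L k) - 1) * \<theta> k)"

end

theory Submission
  imports Defs
begin

text \<open>
  Projecting onto \<open>C\<close> produces an obtuse angle, which gives
  \<open>\<parallel>v\<parallel>\<^sup>2 \<le> - \<alpha> \<langle>grad f x, v\<rangle>\<close> for the search direction \<open>v = log\<^sub>x z\<close>. If a
  cluster point \<open>pbar\<close> were not stationary, compactness would give, near \<open>pbar\<close>, a uniform descent
  rate and a uniform step size below which the line search accepts. Every small step near \<open>pbar\<close> is then
  a first trial, hence \<open>1 / \<beta>\<close> times the preceding step; as the squared displacements are
  bounded by a multiple of the step sizes, going back along such steps never leaves the neighbourhood
  of \<open>pbar\<close>, and the initial step itself would be small. So the step sizes near \<open>pbar\<close> are bounded
  below, and \<open>f\<close> decreases by a fixed amount infinitely often.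
\<close>

subsection \<open>Lorentzian geometry of the hyperboloid\<close>

text \<open>The obstacle is the memory of the line search: \<open>\<theta> (Suc k)\<close> is the
  accepted step divided by \<open>\<beta>\<close>, so a small step close to \<open>pbar\<close> may
  be inherited from iterates far away, where nothing uniform is known. Local estimates alone cannot
  exclude this, hence the tracing backwards in time. Displacements are controlled only through the
  square root of the step. The run may be unbounded, so no bound on the descent rate is available
  along it; but sufficient decrease bounds step times rate by (f(p 0) - m) / \<rho>, where m is a
  lower bound of f on \<open>C\<close>, and the squared displacement is at most
  \<open>\<alpha>hi\<close> times the step times that product. Backwards along first trials the
  steps shrink by the factor \<beta>, so the square roots are summed by a geometric series. The
  estimate for the search direction is immediate from the obtuse angle in flat space; here it rests
  on tanh x / x being nonincreasing. Stationarity pairs the gradient with points of \<open>C\<close>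
  rather than with logarithms. As the gradient is tangent, only the tangential component of the
  point counts, and this is a positive multiple of the logarithm.\<close>

lemma lorentz_inner: "lorentz x y = fst x \<bullet> fst y - snd x * snd y"
  by (simp add: lorentz_def inner_vec_def)

lemma norm_fst_le': "norm (fst x) \<le> norm x" and norm_snd_le': "norm (snd x) \<le> norm x"
  by (cases x; simp add: norm_fst_le norm_snd_le)+

interpretation lorentz: bounded_bilinear "lorentz :: (real^'n) \<times> real \<Rightarrow> _"
proof -
  have "bounded_bilinear (\<lambda>x y :: (real^'n) \<times> real. fst x \<bullet> fst y - snd x * snd y)"
  proof (rule bounded_bilinear.intro)
    show "\<exists>K. \<forall>a b :: (real^'n) \<times> real. norm (fst a \<bullet> fst b - snd a * snd b) \<le> norm a * norm b * K"
    proof (intro exI allI)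
      fix a b :: "(real^'n) \<times> real"
      have "norm (fst a \<bullet> fst b) \<le> norm a * norm b"
        unfolding real_norm_def
        by (rule order_trans[OF Cauchy_Schwarz_ineq2]) (auto intro!: mult_mono intro: norm_fst_le')
      moreover have "norm (snd a * snd b) \<le> norm a * norm b"
        unfolding norm_mult by (auto intro!: mult_mono intro: norm_snd_le' simp del: real_norm_def)
      ultimately show "norm (fst a \<bullet> fst b - snd a * snd b) \<le> norm a * norm b * 2"
        by (simp add: abs_le_iff)
    qed
  qed (auto simp: inner_add algebra_simps)
  then show "bounded_bilinear (lorentz :: (real^'n) \<times> real \<Rightarrow> _)"
    by (simp add: lorentz_inner[abs_def])
qed

lemma lorentz_commute: "lorentz x y = lorentz y x"
  by (simp add: lorentz_inner inner_commute)

lemmas lorentz_simps = lorentz.add_left lorentz.add_right lorentz.diff_left lorentz.diff_right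
  lorentz.scaleR_left lorentz.scaleR_right lorentz.minus_left lorentz.minus_right
  lorentz.zero_left lorentz.zero_right

text \<open>Filling the removable singularity gives the exponential map a single formula that is
  continuous at the zero vector as well.\<close>

definition sinhc :: "real \<Rightarrow> real" where
  "sinhc t = (if t = 0 then 1 else sinh t / t)"

lemma sinhc_0 [simp]: "sinhc 0 = 1"
  by (simp add: sinhc_def)

lemma mult_sinhc: "t * sinhc t = sinh t"
  by (simp add: sinhc_def)

lemma sinhc_abs: "sinhc \<bar>t\<bar> = sinhc t"
  by (simp add: sinhc_def abs_if)

lemma sinhc_pos: "sinhc t > 0"
  by (auto simp: sinhc_def zero_less_divide_iff)

lemma continuous_sinhc: "isCont sinhc t"
proof (cases "t = 0")
  case True
  have "(sinh has_field_derivative cosh 0) (at (0::real))"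
    by (auto intro!: derivative_eq_intros)
  then have "((\<lambda>t. sinh t / t) \<longlongrightarrow> (1::real)) (at 0)"
    by (simp add: has_field_derivative_iff)
  then have "(sinhc \<longlongrightarrow> 1) (at 0)"
    by (rule Lim_transform_eventually) (auto simp: sinhc_def eventually_at_filter)
  then show ?thesis
    by (simp add: True isCont_def)
next
  case False
  then have "isCont (\<lambda>t. sinh t / t) t"
    by (auto intro!: continuous_intros)
  moreover have "\<forall>\<^sub>F s in nhds t. sinhc s = sinh s / s"
    using t1_space_nhds[OF False] by eventually_elim (simp add: sinhc_def)
  ultimately show ?thesis
    using isCont_cong by fastforce
qed

lemma sinh_ge_self: "x \<ge> 0 \<Longrightarrow> sinh x \<ge> (x::real)"
  using real_le_x_sinh[of x] by (simp add: sinh_def exp_minus)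

text \<open>The sign of the derivative of tanh x / x reduces to x <= sinh x * cosh x, which is 2x <=
  sinh (2x).\<close>

lemma tanh_div_self_antimono:
  fixes a b :: real
  assumes "0 < b" "b \<le> a"
  shows "b * tanh a \<le> a * tanh b"
proof -
  have "tanh a / a \<le> tanh b / b"
  proof (rule DERIV_nonpos_imp_nonincreasing[OF assms(2)])
    fix x assume "b \<le> x" "x \<le> a"
    then have x: "x > 0"
      using assms by simp
    have "2 * x \<le> 2 * sinh x * cosh x"
      using sinh_ge_self[of "2 * x"] x by (simp add: sinh_double)
    then have "x / cosh x ^ 2 \<le> tanh x"
      by (simp add: tanh_def field_simps power2_eq_square)
    moreover have "1 - tanh x ^ 2 = 1 / cosh x ^ 2"
      by (simp add: tanh_def field_simps hyperbolic_pythagoras)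
    ultimately have "((1 - tanh x ^ 2) * x - tanh x * 1) / (x * x) \<le> 0"
      using x by (simp add: divide_le_0_iff)
    moreover have "((\<lambda>x. tanh x / x) has_real_derivative
        ((1 - tanh x ^ 2) * x - tanh x * 1) / (x * x)) (at x)"
      using x by (auto intro!: derivative_eq_intros simp: power2_eq_square)
    ultimately show "\<exists>y. ((\<lambda>x. tanh x / x) has_real_derivative y) (at x) \<and> y \<le> 0"
      by blast
  qed
  then show ?thesis
    using assms by (simp add: field_simps)
qed

section \<open>Tangent spaces and the Lorentz form on them\<close>

lemma hyp_space_iff:
  "p \<in> hyp_space \<kappa> \<longleftrightarrow> lorentz p p = - 1 / \<kappa> \<and> snd p > 0"
  by (simp add: hyp_space_def)

lemma hyp_tangent_iff: "v \<in> hyp_tangent p \<longleftrightarrow> lorentz p v = 0"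
  by (simp add: hyp_tangent_def)

lemma hyp_tangent_scaleR: "v \<in> hyp_tangent p \<Longrightarrow> c *\<^sub>R v \<in> hyp_tangent p"
  by (simp add: hyp_tangent_iff lorentz_simps)

lemma lnorm_0 [simp]: "lnorm 0 = 0"
  by (simp add: lnorm_def lorentz_simps)

lemma lnorm_scaleR: "lnorm (c *\<^sub>R v) = \<bar>c\<bar> * lnorm v"
  by (simp add: lnorm_def lorentz_simps real_sqrt_mult flip: mult.assoc)

lemma tendsto_lnorm [tendsto_intros]: "(g \<longlongrightarrow> v) F \<Longrightarrow> ((\<lambda>x. lnorm (g x)) \<longlongrightarrow> lnorm v) F"
  unfolding lnorm_def by (intro tendsto_intros lorentz.tendsto)

text \<open>The Lorentz-orthogonal projection of \<open>q\<close> to the tangent space at a point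
  \<open>p\<close> of the hyperboloid. For distinct points of the hyperboloid it is a positive
  multiple of \<open>hyp_log \<kappa> p q\<close>, so sign conditions on logarithms can be stated
  without the distance factor.\<close>

definition tangent_part :: "real \<Rightarrow> (real^'n) \<times> real \<Rightarrow> (real^'n) \<times> real \<Rightarrow> (real^'n) \<times> real" where
  "tangent_part \<kappa> p q = q + (\<kappa> * lorentz p q) *\<^sub>R p"

lemma hyp_log_eq:
  "hyp_log \<kappa> p q = (if q = p then 0 else hyp_dist \<kappa> p q *\<^sub>R (tangent_part \<kappa> p q /\<^sub>R lnorm (tangent_part \<kappa> p q)))"
  by (simp add: hyp_log_def tangent_part_def Let_def)

lemma convexD_geodesic:
  "hyp_convex \<kappa> C \<Longrightarrow> p \<in> C \<Longrightarrow> q \<in> C \<Longrightarrow> 0 \<le> t \<Longrightarrow> t \<le> 1 \<Longrightarrow> hyp_exp \<kappa> p (t *\<^sub>R hyp_log \<kappa> p q) \<in> C"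
  unfolding hyp_convex_def hyp_segment_def hyp_geodesic_def by fastforce

locale hyperbolic_space =
  fixes \<kappa> :: real
  assumes kappa: "\<kappa> > 0"
begin

text \<open>Quantitative positive definiteness. Tangency says \<open>P \<bullet> A = t * s\<close>,
  and Cauchy-Schwarz with \<open>P \<bullet> P\<close> equal to t^2 - 1/\<kappa> leaves a gap of
  (\<open>A \<bullet> A\<close>) / \<kappa>. The constant grows with the height of \<open>p\<close>,
  so the comparison of norms is uniform on bounded sets only.\<close>

lemma tangent_norm_le:
  assumes p: "p \<in> hyp_space \<kappa>" and v: "v \<in> hyp_tangent p"
  shows "(norm v)\<^sup>2 \<le> 2 * \<kappa> * (snd p)\<^sup>2 * lorentz v v"
proof -
  define P t A s where "P = fst p" and "t = snd p" and "A = fst v" and "s = snd v"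
  have t: "t > 0" and PP: "t\<^sup>2 = P \<bullet> P + 1 / \<kappa>"
    using p by (auto simp: hyp_space_iff lorentz_inner P_def t_def power2_eq_square)
  have "P \<bullet> A = t * s"
    using v by (simp add: hyp_tangent_iff lorentz_inner P_def t_def A_def s_def)
  then have "t\<^sup>2 * s\<^sup>2 \<le> (P \<bullet> P) * (A \<bullet> A)"
    using Cauchy_Schwarz_ineq[of P A] by (simp add: power_mult_distrib)
  then have *: "t\<^sup>2 * s\<^sup>2 \<le> (t\<^sup>2 - 1 / \<kappa>) * (A \<bullet> A)"
    using PP by simp
  have "(t\<^sup>2 - 1 / \<kappa>) * (A \<bullet> A) \<le> t\<^sup>2 * (A \<bullet> A)"
    using kappa by (intro mult_right_mono) auto
  with * have "t\<^sup>2 * s\<^sup>2 \<le> t\<^sup>2 * (A \<bullet> A)"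
    by linarith
  then have "s\<^sup>2 \<le> A \<bullet> A"
    using t by simp
  moreover have "A \<bullet> A \<le> \<kappa> * t\<^sup>2 * (A \<bullet> A - s\<^sup>2)"
    using mult_left_mono[OF *, of \<kappa>] kappa by (simp add: algebra_simps)
  moreover have "(norm v)\<^sup>2 = A \<bullet> A + s\<^sup>2" "lorentz v v = A \<bullet> A - s\<^sup>2"
    by (simp_all add: A_def s_def lorentz_inner norm_prod_def dot_square_norm power2_eq_square[of "snd v"])
  ultimately show ?thesis
    by (simp add: t_def)
qed

lemma lorentz_tangent_nonneg:
  assumes "p \<in> hyp_space \<kappa>" "v \<in> hyp_tangent p"
  shows "lorentz v v \<ge> 0"
proof -
  have "0 \<le> 2 * \<kappa> * (snd p)\<^sup>2 * lorentz v v"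
    using tangent_norm_le[OF assms] zero_le_power2 order_trans by blast
  moreover have "2 * \<kappa> * (snd p)\<^sup>2 > 0"
    using kappa assms(1) by (simp add: hyp_space_iff)
  ultimately show ?thesis
    by (simp only: zero_le_mult_iff) linarith
qed

lemma lnorm_nonneg: "p \<in> hyp_space \<kappa> \<Longrightarrow> v \<in> hyp_tangent p \<Longrightarrow> lnorm v \<ge> 0"
  by (simp add: lnorm_def lorentz_tangent_nonneg)

lemma lnorm_power2:
  "p \<in> hyp_space \<kappa> \<Longrightarrow> v \<in> hyp_tangent p \<Longrightarrow> (lnorm v)\<^sup>2 = lorentz v v"
  by (simp add: lnorm_def lorentz_tangent_nonneg)

lemma lorentz_tangent_eq_0:
  assumes "p \<in> hyp_space \<kappa>" "v \<in> hyp_tangent p" "lorentz v v = 0"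
  shows "v = 0"
  using tangent_norm_le[OF assms(1,2)] assms(3) by simp

lemma lnorm_eq_0:
  "p \<in> hyp_space \<kappa> \<Longrightarrow> v \<in> hyp_tangent p \<Longrightarrow> lnorm v = 0 \<Longrightarrow> v = 0"
  using lnorm_power2 lorentz_tangent_eq_0 by fastforce

lemma norm_le_lnorm:
  assumes p: "p \<in> hyp_space \<kappa>" and v: "v \<in> hyp_tangent p"
  shows "norm v \<le> sqrt (2 * \<kappa>) * snd p * lnorm v"
proof (rule power2_le_imp_le)
  have [simp]: "(lnorm v)\<^sup>2 = lorentz v v"
    using lnorm_power2 assms .
  show "(norm v)\<^sup>2 \<le> (sqrt (2 * \<kappa>) * snd p * lnorm v)\<^sup>2"
    using tangent_norm_le[OF assms] kappa by (simp add: power_mult_distrib)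
  show "0 \<le> sqrt (2 * \<kappa>) * snd p * lnorm v"
    using p kappa lnorm_nonneg[OF assms] by (simp add: hyp_space_iff)
qed

lemma lorentz_tangent_le:
  assumes p: "p \<in> hyp_space \<kappa>" and u: "u \<in> hyp_tangent p" and v: "v \<in> hyp_tangent p"
  shows "lorentz u v \<le> lnorm u * lnorm v"
proof (cases "lnorm u = 0 \<or> lnorm v = 0")
  case True
  then have "u = 0 \<or> v = 0"
    using lnorm_eq_0[OF p] u v by blast
  then show ?thesis
    by (auto simp: lorentz_simps)
next
  case False
  then have pos: "lnorm u * lnorm v > 0"
    using lnorm_nonneg[OF p] u v by (simp add: less_le)
  have "lnorm v *\<^sub>R u - lnorm u *\<^sub>R v \<in> hyp_tangent p"
    using u v by (simp add: hyp_tangent_iff lorentz_simps)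
  then have "0 \<le> lorentz (lnorm v *\<^sub>R u - lnorm u *\<^sub>R v) (lnorm v *\<^sub>R u - lnorm u *\<^sub>R v)"
    using lorentz_tangent_nonneg[OF p] by blast
  also have "\<dots> = 2 * (lnorm u * lnorm v) * (lnorm u * lnorm v - lorentz u v)"
    unfolding lorentz_simps lnorm_power2[OF p u, symmetric] lnorm_power2[OF p v, symmetric]
      lorentz_commute[of v u] by (simp add: algebra_simps power2_eq_square)
  finally show ?thesis
    using pos by (simp add: zero_le_mult_iff)
qed

lemma lorentz_tangent_ge:
  assumes "p \<in> hyp_space \<kappa>" "u \<in> hyp_tangent p" "v \<in> hyp_tangent p"
  shows "- (lnorm u * lnorm v) \<le> lorentz u v"
  using lorentz_tangent_le[OF assms(1) hyp_tangent_scaleR[OF assms(2), of "-1"] assms(3)]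
  by (simp only: lorentz_simps lnorm_scaleR) simp

lemma tangent_part_tangent: "p \<in> hyp_space \<kappa> \<Longrightarrow> tangent_part \<kappa> p q \<in> hyp_tangent p"
  using kappa by (simp add: tangent_part_def hyp_tangent_iff lorentz_simps hyp_space_iff)

lemma lorentz_tangent_part:
  assumes "p \<in> hyp_space \<kappa>"
  shows "lorentz (tangent_part \<kappa> p x) (tangent_part \<kappa> p y) = lorentz x y + \<kappa> * lorentz p x * lorentz p y"
proof -
  have *: "lorentz p p = - 1 / \<kappa>"
    using assms by (simp add: hyp_space_iff)
  show ?thesis
    unfolding tangent_part_def lorentz_simps lorentz_commute[of x p] * using kappa by (simp add: field_simps)
qed

section \<open>Lorentz products of points and the intrinsic distance\<close>

lemma snd_gt_norm_fst:
  assumes "x \<in> hyp_space \<kappa>"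
  shows "norm (fst x) < snd x"
proof (rule power2_less_imp_less)
  have "1 / \<kappa> > 0"
    using kappa by simp
  moreover have "(norm (fst x))\<^sup>2 = (snd x)\<^sup>2 - 1 / \<kappa>" "0 < snd x"
    using assms by (simp_all add: hyp_space_iff lorentz_inner dot_square_norm power2_eq_square[of "snd x"])
  ultimately show "(norm (fst x))\<^sup>2 < (snd x)\<^sup>2" "0 \<le> snd x"
    by simp_all
qed

lemma lorentz_neg:
  assumes "p \<in> hyp_space \<kappa>" "q \<in> hyp_space \<kappa>"
  shows "lorentz p q < 0"
proof -
  have "fst p \<bullet> fst q \<le> norm (fst p) * norm (fst q)"
    by (rule norm_cauchy_schwarz)
  also have "\<dots> < snd p * snd q"
    using snd_gt_norm_fst[OF assms(1)] snd_gt_norm_fst[OF assms(2)] by (intro mult_strict_mono') auto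
  finally show ?thesis
    by (simp add: lorentz_inner)
qed

text \<open>The reversed Cauchy-Schwarz inequality for timelike vectors: the tangential part of
  \<open>q\<close> at \<open>p\<close> has nonnegative square, and the sign comes from both points
  lying on the upper sheet.\<close>

lemma hyp_cosh_ge_1:
  assumes p: "p \<in> hyp_space \<kappa>" and q: "q \<in> hyp_space \<kappa>"
  shows "- \<kappa> * lorentz p q \<ge> 1"
proof (rule power2_le_imp_le)
  have "0 \<le> lorentz q q + \<kappa> * lorentz p q * lorentz p q"
    using lorentz_tangent_nonneg[OF p tangent_part_tangent[OF p, of q]] lorentz_tangent_part[OF p, of q q] by simp
  then have "1 / \<kappa> \<le> \<kappa> * lorentz p q * lorentz p q"
    using q by (simp add: hyp_space_iff)
  then show "1\<^sup>2 \<le> (- \<kappa> * lorentz p q)\<^sup>2"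
    using kappa by (simp add: field_simps power2_eq_square)
  show "0 \<le> - \<kappa> * lorentz p q"
    using lorentz_neg[OF assms] kappa by (simp add: mult_le_0_iff)
qed

lemma hyp_cosh_eq_1:
  assumes p: "p \<in> hyp_space \<kappa>" and q: "q \<in> hyp_space \<kappa>" and "- \<kappa> * lorentz p q = 1"
  shows "p = q"
proof -
  have eq: "\<kappa> * lorentz p q = - 1"
    using assms(3) by simp
  then have "lorentz p q = - 1 / \<kappa>"
    using kappa by (metis mult.commute nonzero_eq_divide_eq less_irrefl)
  then have "lorentz (tangent_part \<kappa> p q) (tangent_part \<kappa> p q) = 0"
    unfolding lorentz_tangent_part[OF p] eq using q \<open>lorentz p q = - 1 / \<kappa>\<close> by (simp add: hyp_space_iff)
  then have "tangent_part \<kappa> p q = 0"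
    using lorentz_tangent_eq_0 tangent_part_tangent p by blast
  then show ?thesis
    by (simp add: tangent_part_def eq)
qed

lemma cosh_hyp_dist:
  assumes "p \<in> hyp_space \<kappa>" "q \<in> hyp_space \<kappa>"
  shows "cosh (sqrt \<kappa> * hyp_dist \<kappa> p q) = - \<kappa> * lorentz p q"
  using hyp_cosh_ge_1[OF assms] kappa unfolding hyp_dist_def by simp

lemma hyp_dist_nonneg:
  assumes "p \<in> hyp_space \<kappa>" "q \<in> hyp_space \<kappa>"
  shows "hyp_dist \<kappa> p q \<ge> 0"
  using hyp_cosh_ge_1[OF assms] kappa unfolding hyp_dist_def by simp

text \<open>Note the reversed order. Through this equivalence, nearest points to \<open>y\<close>
  become maximizers of the linear functional \<open>lorentz y\<close>.\<close>

lemma hyp_dist_le_iff: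
  assumes "p \<in> hyp_space \<kappa>" "q \<in> hyp_space \<kappa>" "p' \<in> hyp_space \<kappa>" "q' \<in> hyp_space \<kappa>"
  shows "hyp_dist \<kappa> p q \<le> hyp_dist \<kappa> p' q' \<longleftrightarrow> lorentz p' q' \<le> lorentz p q"
proof -
  have "hyp_dist \<kappa> p q \<le> hyp_dist \<kappa> p' q' \<longleftrightarrow>
      cosh (sqrt \<kappa> * hyp_dist \<kappa> p q) \<le> cosh (sqrt \<kappa> * hyp_dist \<kappa> p' q')"
    using assms kappa by (subst cosh_real_nonneg_le_iff) (auto simp: hyp_dist_nonneg)
  also have "\<dots> \<longleftrightarrow> lorentz p' q' \<le> lorentz p q"
    using assms kappa by (simp add: cosh_hyp_dist)
  finally show ?thesis .
qed

lemma hyp_dist_commute: "hyp_dist \<kappa> p q = hyp_dist \<kappa> q p"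
  by (simp add: hyp_dist_def lorentz_commute)

lemma lnorm_tangent_part:
  assumes p: "p \<in> hyp_space \<kappa>" and q: "q \<in> hyp_space \<kappa>"
  shows "sqrt \<kappa> * lnorm (tangent_part \<kappa> p q) = sinh (sqrt \<kappa> * hyp_dist \<kappa> p q)"
proof (rule power2_eq_imp_eq)
  have "(sqrt \<kappa> * lnorm (tangent_part \<kappa> p q))\<^sup>2 = \<kappa> * (lorentz q q + \<kappa> * lorentz p q * lorentz p q)"
    unfolding power_mult_distrib lnorm_power2[OF p tangent_part_tangent[OF p]] lorentz_tangent_part[OF p]
    using kappa by simp
  also have "\<dots> = (- \<kappa> * lorentz p q)\<^sup>2 - 1"
    using q kappa by (simp add: hyp_space_iff field_simps power2_eq_square)
  finally show "(sqrt \<kappa> * lnorm (tangent_part \<kappa> p q))\<^sup>2 = (sinh (sqrt \<kappa> * hyp_dist \<kappa> p q))\<^sup>2"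
    unfolding sinh_square_eq cosh_hyp_dist[OF assms] .
  show "0 \<le> sqrt \<kappa> * lnorm (tangent_part \<kappa> p q)"
    using lnorm_nonneg[OF p tangent_part_tangent[OF p]] kappa by simp
  show "0 \<le> sinh (sqrt \<kappa> * hyp_dist \<kappa> p q)"
    using hyp_dist_nonneg[OF assms] kappa by simp
qed

text \<open>The law of cosines at \<open>y\<close>, with the angle term estimated by Cauchy-Schwarz
  in the tangent space, bounds the cosh of the third side by \<open>cosh (a + b)\<close>.\<close>

lemma hyp_dist_triangle:
  assumes x: "x \<in> hyp_space \<kappa>" and y: "y \<in> hyp_space \<kappa>" and z: "z \<in> hyp_space \<kappa>"
  shows "hyp_dist \<kappa> x z \<le> hyp_dist \<kappa> x y + hyp_dist \<kappa> y z"
proof -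
  define a b where "a = sqrt \<kappa> * hyp_dist \<kappa> y x" and "b = sqrt \<kappa> * hyp_dist \<kappa> y z"
  have nn: "a \<ge> 0" "b \<ge> 0" "sqrt \<kappa> * hyp_dist \<kappa> x z \<ge> 0"
    using assms kappa by (auto simp: a_def b_def hyp_dist_nonneg)
  have "- (lnorm (tangent_part \<kappa> y x) * lnorm (tangent_part \<kappa> y z)) \<le> lorentz (tangent_part \<kappa> y x) (tangent_part \<kappa> y z)"
    by (rule lorentz_tangent_ge[OF y tangent_part_tangent[OF y] tangent_part_tangent[OF y]])
  from mult_left_mono[OF this, of \<kappa>]
  have "- (\<kappa> * (lnorm (tangent_part \<kappa> y x) * lnorm (tangent_part \<kappa> y z)))
      \<le> \<kappa> * lorentz x z + (- \<kappa> * lorentz y x) * (- \<kappa> * lorentz y z)"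
    using kappa unfolding lorentz_tangent_part[OF y] by (simp add: algebra_simps)
  moreover have "(sqrt \<kappa> * lnorm (tangent_part \<kappa> y x)) * (sqrt \<kappa> * lnorm (tangent_part \<kappa> y z))
      = \<kappa> * (lnorm (tangent_part \<kappa> y x) * lnorm (tangent_part \<kappa> y z))"
    using kappa real_sqrt_mult_self[of \<kappa>]
    by (metis abs_of_pos mult.assoc mult.left_commute)
  ultimately have "- ((sqrt \<kappa> * lnorm (tangent_part \<kappa> y x)) * (sqrt \<kappa> * lnorm (tangent_part \<kappa> y z)))
      \<le> \<kappa> * lorentz x z + (- \<kappa> * lorentz y x) * (- \<kappa> * lorentz y z)"
    by (simp only:)
  then have "- \<kappa> * lorentz x z \<le> cosh a * cosh b + sinh a * sinh b"
    unfolding lnorm_tangent_part[OF y x] lnorm_tangent_part[OF y z] a_def b_def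
      cosh_hyp_dist[OF y x] cosh_hyp_dist[OF y z] by linarith
  then have "cosh (sqrt \<kappa> * hyp_dist \<kappa> x z) \<le> cosh (a + b)"
    using cosh_hyp_dist[OF x z] by (simp add: cosh_add)
  then have "sqrt \<kappa> * hyp_dist \<kappa> x z \<le> a + b"
    using nn by (simp add: cosh_real_nonneg_le_iff)
  then have "sqrt \<kappa> * hyp_dist \<kappa> x z \<le> sqrt \<kappa> * (hyp_dist \<kappa> x y + hyp_dist \<kappa> y z)"
    by (simp add: a_def b_def hyp_dist_commute[of y x] algebra_simps)
  then show ?thesis
    using kappa by simp
qed

section \<open>Exponential and logarithm maps\<close>

lemma hyp_exp_eq:
  assumes p: "p \<in> hyp_space \<kappa>" and v: "v \<in> hyp_tangent p"
  shows "hyp_exp \<kappa> p v = cosh (sqrt \<kappa> * lnorm v) *\<^sub>R p + sinhc (sqrt \<kappa> * lnorm v) *\<^sub>R v"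
proof (cases "v = 0")
  case False
  then have "sqrt \<kappa> * lnorm v \<noteq> 0"
    using lnorm_eq_0[OF assms] kappa by auto
  with False show ?thesis
    by (simp add: hyp_exp_def sinhc_def divide_inverse)
qed (simp add: hyp_exp_def)

lemma lorentz_hyp_exp_base:
  assumes p: "p \<in> hyp_space \<kappa>" and v: "v \<in> hyp_tangent p"
  shows "lorentz p (hyp_exp \<kappa> p v) = - cosh (sqrt \<kappa> * lnorm v) / \<kappa>"
  using assms by (simp add: hyp_exp_eq lorentz_simps hyp_space_iff hyp_tangent_iff)

lemma hyp_exp_in:
  assumes p: "p \<in> hyp_space \<kappa>" and v: "v \<in> hyp_tangent p"
  shows "hyp_exp \<kappa> p v \<in> hyp_space \<kappa>"
proof -
  define a where "a = sqrt \<kappa> * lnorm v"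
  have a2: "a\<^sup>2 = \<kappa> * lorentz v v"
    using kappa by (simp add: a_def power_mult_distrib lnorm_power2[OF assms])
  have e: "hyp_exp \<kappa> p v = cosh a *\<^sub>R p + sinhc a *\<^sub>R v"
    using hyp_exp_eq[OF assms] by (simp add: a_def)
  have pp: "lorentz p p = - 1 / \<kappa>" "snd p > 0" "lorentz p v = 0" "lorentz v p = 0"
    using p v by (auto simp: hyp_space_iff hyp_tangent_iff lorentz_commute)
  have "lorentz v v = a\<^sup>2 / \<kappa>"
    using a2 kappa by simp
  then have "lorentz (hyp_exp \<kappa> p v) (hyp_exp \<kappa> p v) = ((a * sinhc a)\<^sup>2 - (cosh a)\<^sup>2) / \<kappa>"
    unfolding e lorentz_simps pp using kappa by (simp add: field_simps power2_eq_square)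
  also have "\<dots> = - 1 / \<kappa>"
    by (simp add: mult_sinhc cosh_square_eq)
  finally have q: "lorentz (hyp_exp \<kappa> p v) (hyp_exp \<kappa> p v) = - 1 / \<kappa>" .
  have neg: "lorentz p (hyp_exp \<kappa> p v) < 0"
    using lorentz_hyp_exp_base[OF assms] kappa by (simp add: divide_neg_pos)
  \<comment> \<open>Otherwise the antipode of the endpoint lies on the upper sheet, and its product
    with \<open>p\<close> would have to be negative, against \<open>neg\<close>.\<close>
  have "snd (hyp_exp \<kappa> p v) > 0"
  proof (rule ccontr)
    assume "\<not> ?thesis"
    moreover have "snd (hyp_exp \<kappa> p v) \<noteq> 0"
    proof
      assume "snd (hyp_exp \<kappa> p v) = 0"
      then have "lorentz (hyp_exp \<kappa> p v) (hyp_exp \<kappa> p v) \<ge> 0"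
        by (simp add: lorentz_inner)
      then show False
        using q kappa by (simp add: zero_le_divide_iff)
    qed
    ultimately have "- hyp_exp \<kappa> p v \<in> hyp_space \<kappa>"
      using q by (simp add: hyp_space_iff lorentz_simps)
    then show False
      using lorentz_neg[OF p] neg by (fastforce simp: lorentz_simps)
  qed
  with q show ?thesis
    by (simp add: hyp_space_iff)
qed

lemma hyp_dist_exp:
  assumes p: "p \<in> hyp_space \<kappa>" and v: "v \<in> hyp_tangent p"
  shows "hyp_dist \<kappa> p (hyp_exp \<kappa> p v) = lnorm v"
  using kappa lnorm_nonneg[OF assms]
  by (simp add: hyp_dist_def lorentz_hyp_exp_base[OF assms] arcosh_cosh_real)

lemma hyp_log_tangent: "p \<in> hyp_space \<kappa> \<Longrightarrow> hyp_log \<kappa> p q \<in> hyp_tangent p"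
  using tangent_part_tangent[of p q]
  by (simp add: hyp_log_eq hyp_tangent_iff lorentz_simps)

lemma hyp_dist_pos:
  assumes "p \<in> hyp_space \<kappa>" "q \<in> hyp_space \<kappa>" "p \<noteq> q"
  shows "hyp_dist \<kappa> p q > 0"
proof -
  have "hyp_dist \<kappa> p q \<noteq> 0"
    using cosh_hyp_dist[OF assms(1,2)] hyp_cosh_eq_1[OF assms(1,2)] assms(3) by force
  then show ?thesis
    using hyp_dist_nonneg[OF assms(1,2)] by simp
qed

lemma hyp_log_unit:
  assumes p: "p \<in> hyp_space \<kappa>" and q: "q \<in> hyp_space \<kappa>" and "q \<noteq> p"
  shows "lnorm (tangent_part \<kappa> p q) > 0" "lnorm (hyp_log \<kappa> p q) = hyp_dist \<kappa> p q"
proof -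
  have d: "hyp_dist \<kappa> p q > 0"
    by (rule hyp_dist_pos[OF p q assms(3)[symmetric]])
  then have "sinh (sqrt \<kappa> * hyp_dist \<kappa> p q) > 0"
    using kappa by simp
  then show "lnorm (tangent_part \<kappa> p q) > 0"
    unfolding lnorm_tangent_part[OF p q, symmetric] using kappa by (simp add: zero_less_mult_iff)
  then show "lnorm (hyp_log \<kappa> p q) = hyp_dist \<kappa> p q"
    using assms(3) d by (simp add: hyp_log_eq lnorm_scaleR)
qed

lemma hyp_exp_log:
  assumes p: "p \<in> hyp_space \<kappa>" and q: "q \<in> hyp_space \<kappa>"
  shows "hyp_exp \<kappa> p (hyp_log \<kappa> p q) = q"
proof (cases "q = p")
  case True
  then show ?thesis
    by (simp add: hyp_exp_def hyp_log_def)
next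
  case False
  define d m where "d = hyp_dist \<kappa> p q" and "m = lnorm (tangent_part \<kappa> p q)"
  have m: "m > 0" "lnorm (hyp_log \<kappa> p q) = d" and d: "d > 0"
    using hyp_log_unit[OF p q False] hyp_dist_pos[OF p q False[symmetric]] by (auto simp: d_def m_def)
  have s: "sinh (sqrt \<kappa> * d) = sqrt \<kappa> * m" and c: "cosh (sqrt \<kappa> * d) = - \<kappa> * lorentz p q"
    using lnorm_tangent_part[OF p q] cosh_hyp_dist[OF p q] by (auto simp: d_def m_def)
  have l: "hyp_log \<kappa> p q = (d / m) *\<^sub>R tangent_part \<kappa> p q"
    using False by (simp add: hyp_log_eq d_def m_def divide_inverse)
  have "sinhc (sqrt \<kappa> * d) = m / d"
    using s d kappa by (simp add: sinhc_def)
  then have "hyp_exp \<kappa> p (hyp_log \<kappa> p q) = (- \<kappa> * lorentz p q) *\<^sub>R p + (m / d * (d / m)) *\<^sub>R tangent_part \<kappa> p q"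
    unfolding hyp_exp_eq[OF p hyp_log_tangent[OF p]] m c unfolding l by simp
  also have "\<dots> = q"
    using m(1) d by (simp add: tangent_part_def)
  finally show ?thesis .
qed

text \<open>Evenness of \<open>cosh\<close> and \<open>sinhc\<close> removes the absolute value of
  \<open>t\<close>, so the formula is smooth across \<open>t = 0\<close> and gives a two-sided
  derivative there.\<close>

lemma hyp_exp_ray:
  assumes p: "p \<in> hyp_space \<kappa>" and v: "v \<in> hyp_tangent p"
  shows "hyp_exp \<kappa> p (t *\<^sub>R v)
    = cosh (sqrt \<kappa> * lnorm v * t) *\<^sub>R p + (t * sinhc (sqrt \<kappa> * lnorm v * t)) *\<^sub>R v"
proof -
  have eq: "sqrt \<kappa> * (\<bar>t\<bar> * lnorm v) = \<bar>sqrt \<kappa> * lnorm v * t\<bar>"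
    using lnorm_nonneg[OF p v] kappa by (simp add: abs_mult)
  show ?thesis
    unfolding hyp_exp_eq[OF p hyp_tangent_scaleR[OF v]] lnorm_scaleR eq sinhc_abs cosh_real_abs
    by simp
qed

lemma hyp_exp_ray_has_vector_derivative:
  assumes p: "p \<in> hyp_space \<kappa>" and v: "v \<in> hyp_tangent p"
  defines "a \<equiv> sqrt \<kappa> * lnorm v"
  shows "((\<lambda>t. hyp_exp \<kappa> p (t *\<^sub>R v)) has_vector_derivative
    (a * sinh (a * t)) *\<^sub>R p + cosh (a * t) *\<^sub>R v) (at t)"
proof (cases "v = 0")
  case True
  then show ?thesis
    by (simp add: hyp_exp_def a_def)
next
  case False
  then have a: "a \<noteq> 0"
    using lnorm_eq_0[OF p v] kappa by (auto simp: a_def)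
  have eq: "t * sinhc (a * t) = sinh (a * t) / a" for t
    using a by (simp add: sinhc_def)
  have "((\<lambda>t. cosh (a * t) *\<^sub>R p + (sinh (a * t) / a) *\<^sub>R v) has_vector_derivative
    (a * sinh (a * t)) *\<^sub>R p + cosh (a * t) *\<^sub>R v) (at t)"
    using a by (auto intro!: derivative_eq_intros simp: field_simps)
  then show ?thesis
    unfolding hyp_exp_ray[OF p v] eq[unfolded a_def] a_def .
qed

section \<open>Projection onto a closed convex set\<close>

lemma lorentz_maximizer_first_order:
  assumes C: "C \<subseteq> hyp_space \<kappa>" "hyp_convex \<kappa> C"
    and z: "z \<in> C" and min: "\<And>q. q \<in> C \<Longrightarrow> lorentz y q \<le> lorentz y z" and q: "q \<in> C"
  shows "lorentz y (tangent_part \<kappa> z q) \<le> 0"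
proof (cases "q = z")
  case True
  then have "tangent_part \<kappa> z q = 0"
    using z C kappa by (auto simp: tangent_part_def hyp_space_iff)
  then show ?thesis
    by (simp add: lorentz_simps)
next
  case False
  have zH: "z \<in> hyp_space \<kappa>" and qH: "q \<in> hyp_space \<kappa>"
    using C z q by auto
  define v where "v = hyp_log \<kappa> z q"
  define \<phi> where "\<phi> t = lorentz y (hyp_exp \<kappa> z (t *\<^sub>R v))" for t
  have v: "v \<in> hyp_tangent z"
    by (simp add: v_def hyp_log_tangent[OF zH])
  have "(\<phi> has_vector_derivative lorentz y ((sqrt \<kappa> * lnorm v * sinh (sqrt \<kappa> * lnorm v * 0)) *\<^sub>R z
      + cosh (sqrt \<kappa> * lnorm v * 0) *\<^sub>R v)) (at 0)"
    unfolding \<phi>_def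
    by (intro bounded_linear.has_vector_derivative[OF lorentz.bounded_linear_right]
      hyp_exp_ray_has_vector_derivative zH v)
  then have der: "DERIV \<phi> 0 :> lorentz y v"
    by (simp add: has_real_derivative_iff_has_vector_derivative)
  \<comment> \<open>A positive derivative of \<open>\<phi>\<close> at 0 would increase
    \<open>lorentz y\<close> along the geodesic towards \<open>q\<close>, which convexity keeps
    inside \<open>C\<close>.\<close>
  have "lorentz y v \<le> 0"
  proof (rule ccontr)
    assume "\<not> ?thesis"
    then obtain d where d: "d > 0" "\<And>h. 0 < h \<Longrightarrow> h < d \<Longrightarrow> \<phi> 0 < \<phi> (0 + h)"
      using DERIV_pos_inc_right[OF der] by auto
    define h where "h = min (d / 2) 1"
    have h: "0 < h" "h < d" "h \<le> 1"
      using d(1) by (auto simp: h_def)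
    have "hyp_exp \<kappa> z (h *\<^sub>R v) \<in> C"
      using convexD_geodesic[OF C(2) z q, of h] h by (simp add: v_def)
    then have "\<phi> h \<le> \<phi> 0"
      using min by (simp add: \<phi>_def hyp_exp_def)
    with d(2)[of h] h show False
      by simp
  qed
  define c where "c = hyp_dist \<kappa> z q / lnorm (tangent_part \<kappa> z q)"
  have v_eq: "v = c *\<^sub>R tangent_part \<kappa> z q"
    using False by (simp add: v_def hyp_log_eq c_def divide_inverse)
  have "c > 0"
    unfolding c_def using hyp_log_unit(1)[OF zH qH False] hyp_dist_pos[OF zH qH False[symmetric]] by simp
  then show ?thesis
    using \<open>lorentz y v \<le> 0\<close> unfolding v_eq by (simp add: lorentz.scaleR_right mult_le_0_iff)
qed

text \<open>Superlevel sets of \<open>lorentz y\<close> on the upper sheet are bounded because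
  \<open>y\<close> is strictly timelike: - \<open>lorentz y q\<close> is at least
  \<open>snd q\<close> times the positive gap between \<open>snd y\<close> and the norm of
  \<open>fst y\<close>.\<close>

lemma lorentz_maximizer_exists:
  assumes C: "C \<subseteq> hyp_space \<kappa>" "closed C" "C \<noteq> {}" and y: "y \<in> hyp_space \<kappa>"
  obtains z where "z \<in> C" "\<And>q. q \<in> C \<Longrightarrow> lorentz y q \<le> lorentz y z"
proof -
  obtain q0 where q0: "q0 \<in> C"
    using C by blast
  define K where "K = C \<inter> {q. lorentz y q0 \<le> lorentz y q}"
  have cont: "continuous_on A (lorentz y)" for A
    using lorentz.bounded_linear_right by (rule linear_continuous_on)
  have "closed K"
    unfolding K_def by (intro closed_Int C closed_Collect_le continuous_on_const cont)
  moreover have "bounded K"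
  proof (rule boundedI)
    fix q assume q: "q \<in> K"
    then have qH: "norm (fst q) < snd q"
      using C(1) by (intro snd_gt_norm_fst) (auto simp: K_def)
    note yH = snd_gt_norm_fst[OF y]
    have "snd q * (snd y - norm (fst y)) = snd q * snd y - norm (fst y) * snd q"
      by (simp add: algebra_simps)
    also have "\<dots> \<le> snd q * snd y - norm (fst y) * norm (fst q)"
      using qH by (simp add: mult_left_mono)
    also have "\<dots> \<le> snd q * snd y - fst y \<bullet> fst q"
      using norm_cauchy_schwarz[of "fst y" "fst q"] by simp
    also have "\<dots> \<le> - lorentz y q0"
      using q by (simp add: K_def lorentz_inner mult.commute)
    finally have *: "snd q \<le> - lorentz y q0 / (snd y - norm (fst y))"
      using yH by (subst pos_le_divide_eq) simp_all
    have "norm q \<le> norm (fst q) + norm (snd q)"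
      by (metis norm_Pair_le prod.collapse)
    also have "\<dots> \<le> 2 * snd q"
      using qH by (smt (verit) norm_ge_zero real_norm_def)
    also have "\<dots> \<le> 2 * (- lorentz y q0 / (snd y - norm (fst y)))"
      using * by simp
    finally show "norm q \<le> 2 * (- lorentz y q0 / (snd y - norm (fst y)))" .
  qed
  ultimately have "compact K"
    by (simp add: compact_eq_bounded_closed)
  moreover have "q0 \<in> K"
    by (simp add: K_def q0)
  moreover from this have "K \<noteq> {}"
    by blast
  ultimately obtain z where z: "z \<in> K" "\<And>q. q \<in> K \<Longrightarrow> lorentz y q \<le> lorentz y z"
    using continuous_attains_sup[OF _ _ cont[of K]] by metis
  show thesis
  proof (rule that)
    show "z \<in> C"
      using z by (simp add: K_def)
    show "lorentz y q \<le> lorentz y z" if "q \<in> C" for q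
      using z(2)[of q] z(2)[OF \<open>q0 \<in> K\<close>] that by (cases "q \<in> K") (auto simp: K_def)
  qed
qed

lemma hyp_proj_props:
  assumes C: "C \<subseteq> hyp_space \<kappa>" "closed C" "C \<noteq> {}" "hyp_convex \<kappa> C" and y: "y \<in> hyp_space \<kappa>"
  shows "hyp_proj \<kappa> C y \<in> C"
    and "q \<in> C \<Longrightarrow> lorentz y (tangent_part \<kappa> (hyp_proj \<kappa> C y) q) \<le> 0"
proof -
  obtain z where z: "z \<in> C" "\<And>q. q \<in> C \<Longrightarrow> lorentz y q \<le> lorentz y z"
    using lorentz_maximizer_exists[OF C(1-3) y] by blast
  have arg_min: "is_arg_min (hyp_dist \<kappa> y) (\<lambda>q. q \<in> C) w \<longleftrightarrow> w \<in> C \<and> (\<forall>q\<in>C. lorentz y q \<le> lorentz y w)"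
    for w
    using C(1) y hyp_dist_le_iff[OF y _ y] unfolding is_arg_min_def
    by (meson linorder_not_less subsetD)
  \<comment> \<open>The first-order condition at \<open>w\<close>, tested with the other maximizer
    \<open>z\<close>, factors as \<open>lorentz y w * (1 + \<kappa> * lorentz w z) \<le> 0\<close>.
    The first factor is negative, so the cosh of the scaled distance from \<open>w\<close> to
    \<open>z\<close> is at most 1.\<close>
  have uniq: "w = z" if w: "w \<in> C" "\<And>q. q \<in> C \<Longrightarrow> lorentz y q \<le> lorentz y w" for w
  proof -
    have H: "w \<in> hyp_space \<kappa>" "z \<in> hyp_space \<kappa>"
      using w z C by auto
    have "lorentz y (tangent_part \<kappa> w z) \<le> 0"
      using lorentz_maximizer_first_order[OF C(1,4) w z(1)] .
    moreover have "lorentz y z = lorentz y w"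
      using w z by (intro antisym) auto
    ultimately have "lorentz y w * (1 + \<kappa> * lorentz w z) \<le> 0"
      by (simp add: tangent_part_def lorentz_simps algebra_simps)
    then have "1 + \<kappa> * lorentz w z \<ge> 0"
      using lorentz_neg[OF y H(1)] by (simp add: mult_le_0_iff)
    then have "- \<kappa> * lorentz w z = 1"
      using hyp_cosh_ge_1[OF H] by simp
    then show "w = z"
      using hyp_cosh_eq_1[OF H] by simp
  qed
  have "hyp_proj \<kappa> C y = z"
    unfolding hyp_proj_def
  proof (rule the_equality)
    show "is_arg_min (hyp_dist \<kappa> y) (\<lambda>q. q \<in> C) z"
      using z by (simp add: arg_min)
    show "w = z" if "is_arg_min (hyp_dist \<kappa> y) (\<lambda>q. q \<in> C) w" for w
      using that by (intro uniq) (simp_all add: arg_min)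
  qed
  then show "hyp_proj \<kappa> C y \<in> C" "q \<in> C \<Longrightarrow> lorentz y (tangent_part \<kappa> (hyp_proj \<kappa> C y) q) \<le> 0"
    using z(1) lorentz_maximizer_first_order[OF C(1,4) z] by simp_all
qed

text \<open>The hyperbolic law of cosines for the hinge at \<open>p\<close> spanned by
  \<open>u\<close> and \<open>v\<close>; \<open>sinhc\<close> replaces unit vectors, so zero sides
  are covered.\<close>

lemma lorentz_exp_exp:
  assumes p: "p \<in> hyp_space \<kappa>" and u: "u \<in> hyp_tangent p" and v: "v \<in> hyp_tangent p"
  shows "\<kappa> * lorentz (hyp_exp \<kappa> p u) (hyp_exp \<kappa> p v) =
    sinhc (sqrt \<kappa> * lnorm u) * sinhc (sqrt \<kappa> * lnorm v) * (\<kappa> * lorentz u v)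
    - cosh (sqrt \<kappa> * lnorm u) * cosh (sqrt \<kappa> * lnorm v)"
proof -
  have *: "lorentz p p = - 1 / \<kappa>" "lorentz p v = 0" "lorentz u p = 0"
    using assms by (auto simp: hyp_space_iff hyp_tangent_iff lorentz_commute)
  show ?thesis
    unfolding hyp_exp_eq[OF p u] hyp_exp_eq[OF p v] lorentz_simps *
    using kappa by (simp add: field_simps)
qed

text \<open>
  The angle at the projection \<open>z = exp\<^sub>p v\<close> of \<open>y = exp\<^sub>p u\<close> is at least a right
  angle, so the hyperbolic Pythagorean inequality and the law of cosines at \<open>p\<close> bound the cosine of
  the angle between \<open>u\<close> and \<open>v\<close> from below by a quotient of hyperbolic tangents.
\<close>
lemma projection_direction:
  assumes p: "p \<in> hyp_space \<kappa>" and u: "u \<in> hyp_tangent p" and v: "v \<in> hyp_tangent p"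
    and le: "lorentz (hyp_exp \<kappa> p u) (tangent_part \<kappa> (hyp_exp \<kappa> p v) p) \<le> 0"
  shows "lorentz v v \<le> lorentz u v"
proof (cases "v = 0")
  case True
  then show ?thesis
    by (simp add: lorentz_simps)
next
  case False
  define a b X where "a = sqrt \<kappa> * lnorm u" and "b = sqrt \<kappa> * lnorm v" and "X = \<kappa> * lorentz u v"
  have a: "a \<ge> 0" and b: "b > 0"
    using lnorm_nonneg[OF p u] lnorm_nonneg[OF p v] lnorm_eq_0[OF p v] kappa False
    by (auto simp: a_def b_def less_le)
  have sq: "sqrt \<kappa> * s * (sqrt \<kappa> * t) = \<kappa> * (s * t)" for s t
    using kappa real_sqrt_mult_self[of \<kappa>] by (metis abs_of_pos mult.assoc mult.left_commute)
  have b2: "b * b = \<kappa> * lorentz v v"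
    unfolding b_def sq lnorm_power2[OF p v, symmetric] by (simp add: power2_eq_square)
  have Xab: "X \<le> a * b"
    using mult_left_mono[OF lorentz_tangent_le[OF p u v], of \<kappa>] kappa
    by (simp add: X_def a_def b_def sq)
  have yp: "\<kappa> * lorentz (hyp_exp \<kappa> p u) p = - cosh a"
    and zp: "\<kappa> * lorentz (hyp_exp \<kappa> p v) p = - cosh b"
    using kappa lorentz_hyp_exp_base[OF p u] lorentz_hyp_exp_base[OF p v]
    by (simp_all add: a_def b_def lorentz_commute[of "hyp_exp \<kappa> p u" p] lorentz_commute[of "hyp_exp \<kappa> p v" p])
  have yz: "\<kappa> * lorentz (hyp_exp \<kappa> p u) (hyp_exp \<kappa> p v) = sinhc a * sinhc b * X - cosh a * cosh b"
    using lorentz_exp_exp[OF p u v] by (simp add: a_def b_def X_def)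
  have "\<kappa> * lorentz (hyp_exp \<kappa> p u) (tangent_part \<kappa> (hyp_exp \<kappa> p v) p) \<le> 0"
    using le kappa by (simp add: mult_le_0_iff)
  \<comment> \<open>This is the Pythagorean inequality cosh b * cosh d <= cosh a, where d is the
    scaled distance between the two endpoints. The formula \<open>yz\<close> then expresses cosh d
    by the hinge at \<open>p\<close>.\<close>
  then have "\<kappa> * lorentz (hyp_exp \<kappa> p u) p
      + (\<kappa> * lorentz (hyp_exp \<kappa> p v) p) * (\<kappa> * lorentz (hyp_exp \<kappa> p u) (hyp_exp \<kappa> p v)) \<le> 0"
    by (simp add: tangent_part_def lorentz_simps algebra_simps)
  then have "cosh a * (cosh b)\<^sup>2 - cosh a \<le> cosh b * sinhc a * sinhc b * X"
    unfolding yp zp yz by (simp add: algebra_simps power2_eq_square)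
  then have "cosh a * sinh b * (b * sinhc b) \<le> cosh b * sinhc a * sinhc b * X"
    unfolding cosh_square_eq mult_sinhc by (simp add: algebra_simps power2_eq_square)
  then have "sinhc b * (cosh a * sinh b * b) \<le> sinhc b * (cosh b * sinhc a * X)"
    by (simp add: algebra_simps)
  then have *: "cosh a * sinh b * b \<le> cosh b * sinhc a * X"
    by (simp add: sinhc_pos)
  have "cosh a * sinh b * b > 0"
    using b by simp
  with * have "0 < cosh b * sinhc a * X"
    by linarith
  then have X: "X > 0"
    by (rule zero_less_mult_pos) (simp add: sinhc_pos)
  then have a: "a > 0"
    using Xab a by (cases "a = 0") auto
  have "cosh a * sinh b * b * a \<le> cosh b * sinh a * X"
    using mult_left_mono[OF *, of a] a by (simp add: mult_sinhc[symmetric] algebra_simps)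
  \<comment> \<open>With X / (a * b) as the cosine of the angle at \<open>p\<close>, this reads tanh
    b / tanh a <= cosine. As a cosine is at most 1, b <= a follows, and then tanh x / x being
    nonincreasing improves the lower bound to b / a.\<close>
  then have tX: "tanh b * (a * b) \<le> tanh a * X"
    by (simp add: tanh_def field_simps)
  also have "\<dots> \<le> tanh a * (a * b)"
    using Xab a by simp
  finally have "tanh b \<le> tanh a"
    using a b by simp
  then have "b * tanh a \<le> a * tanh b"
    using b by (intro tanh_div_self_antimono) auto
  then have "tanh a * (b * b) \<le> tanh b * (a * b)"
    using b by (simp add: mult.commute mult.left_commute)
  with tX have "tanh a * (b * b) \<le> tanh a * X"
    by linarith
  then have "b * b \<le> X"
    using a by simp
  then show ?thesis
    using b2 kappa by (simp add: X_def)
qed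

text \<open>Turns the projection inequality at a fixed point of the step into stationarity:
  \<open>tangent_part \<kappa> p q\<close> is orthogonal to \<open>p\<close>, so only the component
  of the exponential along \<open>u\<close> survives, with the positive factor
  \<open>sinhc\<close>.\<close>

lemma lorentz_le_0_if_exp_variational:
  assumes p: "p \<in> hyp_space \<kappa>" and u: "u \<in> hyp_tangent p"
    and "lorentz (hyp_exp \<kappa> p u) (tangent_part \<kappa> p q) \<le> 0"
  shows "lorentz u q \<le> 0"
proof -
  have "lorentz u (tangent_part \<kappa> p q) = lorentz u q" "lorentz p (tangent_part \<kappa> p q) = 0"
    using tangent_part_tangent[OF p, of q] u
    by (auto simp: hyp_tangent_iff tangent_part_def lorentz_simps lorentz_commute)
  then show ?thesis
    using assms(3) sinhc_pos[of "sqrt \<kappa> * lnorm u"]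
    by (simp add: hyp_exp_eq[OF p u] lorentz_simps mult_le_0_iff)
qed

section \<open>Euclidean versus intrinsic convergence\<close>

lemma tendsto_hyp_exp:
  assumes "\<And>j. x j \<in> hyp_space \<kappa>" "\<And>j. v j \<in> hyp_tangent (x j)"
    and x: "x \<longlonglongrightarrow> x'" "x' \<in> hyp_space \<kappa>" and v: "v \<longlonglongrightarrow> v'" "v' \<in> hyp_tangent x'"
  shows "(\<lambda>j. hyp_exp \<kappa> (x j) (v j)) \<longlonglongrightarrow> hyp_exp \<kappa> x' v'"
proof -
  have "(\<lambda>j. sinhc (sqrt \<kappa> * lnorm (v j))) \<longlonglongrightarrow> sinhc (sqrt \<kappa> * lnorm v')"
    by (rule isCont_tendsto_compose[OF continuous_sinhc]) (intro tendsto_intros v)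
  then show ?thesis
    unfolding hyp_exp_eq[OF assms(1,2)] hyp_exp_eq[OF x(2) v(2)]
    by (intro tendsto_intros x v)
qed

lemma hyp_exp_0: "hyp_exp \<kappa> p 0 = p"
  by (simp add: hyp_exp_def)

lemma zero_tangent: "0 \<in> hyp_tangent p"
  by (simp add: hyp_tangent_iff lorentz_simps)

lemma hyp_dist_self: "p \<in> hyp_space \<kappa> \<Longrightarrow> hyp_dist \<kappa> p p = 0"
  using hyp_dist_exp[OF _ zero_tangent, of p] by (simp add: hyp_exp_0)

lemma lnorm_hyp_log:
  assumes "p \<in> hyp_space \<kappa>" "q \<in> hyp_space \<kappa>"
  shows "lnorm (hyp_log \<kappa> p q) = hyp_dist \<kappa> p q"
proof (cases "q = p")
  case True
  then show ?thesis
    using hyp_dist_self[OF assms(1)] by (simp add: hyp_log_def)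
qed (rule hyp_log_unit(2)[OF assms])

lemma tendsto_if_hyp_dist:
  assumes x: "\<And>j. x j \<in> hyp_space \<kappa>" and p: "p \<in> hyp_space \<kappa>"
    and lim: "(\<lambda>j. hyp_dist \<kappa> p (x j)) \<longlonglongrightarrow> 0"
  shows "x \<longlonglongrightarrow> p"
proof -
  have "(\<lambda>j. hyp_log \<kappa> p (x j)) \<longlonglongrightarrow> 0"
  proof (rule Lim_null_comparison)
    show "\<forall>\<^sub>F j in sequentially. norm (hyp_log \<kappa> p (x j)) \<le> sqrt (2 * \<kappa>) * snd p * hyp_dist \<kappa> p (x j)"
      by (intro always_eventually allI)
        (use norm_le_lnorm[OF p hyp_log_tangent[OF p]] lnorm_hyp_log[OF p x] in metis)
    show "(\<lambda>j. sqrt (2 * \<kappa>) * snd p * hyp_dist \<kappa> p (x j)) \<longlonglongrightarrow> 0"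
      using tendsto_mult_right_zero[OF lim] .
  qed
  then have "(\<lambda>j. hyp_exp \<kappa> p (hyp_log \<kappa> p (x j))) \<longlonglongrightarrow> hyp_exp \<kappa> p 0"
    using p by (intro tendsto_hyp_exp) (auto simp: hyp_log_tangent zero_tangent)
  then show ?thesis
    by (simp add: hyp_exp_log[OF p x] hyp_exp_0)
qed

lemma hyp_dist_tendsto_0:
  assumes x: "\<And>j. x j \<in> hyp_space \<kappa>" and p: "p \<in> hyp_space \<kappa>" and lim: "x \<longlonglongrightarrow> p"
  shows "(\<lambda>j. hyp_dist \<kappa> p (x j)) \<longlonglongrightarrow> 0"
proof -
  have "(\<lambda>j. - \<kappa> * lorentz p (x j)) \<longlonglongrightarrow> - \<kappa> * lorentz p p"
    by (intro tendsto_intros lorentz.tendsto lim)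
  then have "(\<lambda>j. arcosh (- \<kappa> * lorentz p (x j))) \<longlonglongrightarrow> arcosh (- \<kappa> * lorentz p p)"
    by (rule continuous_on_tendsto_compose[OF continuous_on_arcosh[OF order_refl]])
       (use hyp_cosh_ge_1[OF p] x p in auto)
  from tendsto_mult_left[OF this, of "1 / sqrt \<kappa>"] show ?thesis
    using hyp_dist_self[OF p] kappa by (simp add: hyp_dist_def)
qed

subsection \<open>The gradient along geodesics\<close>

text \<open>Shows that the description in \<open>hyp_grad\<close> denotes. The derivative is
  represented by the Euclidean vector \<open>e\<close>; negating its time coordinate gives a Lorentz
  representative, whose tangential part is the gradient. Uniqueness is positive definiteness on the
  tangent space.\<close>

lemma hyp_grad_props:
  assumes p: "p \<in> hyp_space \<kappa>" and f: "f differentiable (at p within hyp_space \<kappa>)"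
  shows "hyp_grad \<kappa> f p \<in> hyp_tangent p"
    and "v \<in> hyp_tangent p \<Longrightarrow>
      frechet_derivative f (at p within hyp_space \<kappa>) v = lorentz (hyp_grad \<kappa> f p) v"
proof -
  define D where "D = frechet_derivative f (at p within hyp_space \<kappa>)"
  have lin: "linear D"
    unfolding D_def by (rule linear_frechet_derivative[OF f])
  define e where "e = adjoint D 1"
  have De: "D v = e \<bullet> v" for v
    using adjoint_works[OF lin, of v 1] by (simp add: e_def inner_commute)
  define Je where "Je = (fst e, - snd e)"
  have DJ: "D v = lorentz Je v" for v
    by (simp add: De lorentz_inner Je_def inner_prod_def)
  define g where "g = tangent_part \<kappa> p Je"
  have g: "g \<in> hyp_tangent p" "\<And>v. v \<in> hyp_tangent p \<Longrightarrow> D v = lorentz g v"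
    using tangent_part_tangent[OF p] by (auto simp: g_def DJ tangent_part_def lorentz_simps hyp_tangent_iff)
  have "hyp_grad \<kappa> f p = g"
    unfolding hyp_grad_def D_def[symmetric]
  proof (rule the_equality)
    fix h assume h: "h \<in> hyp_tangent p \<and> (\<forall>v\<in>hyp_tangent p. D v = lorentz h v)"
    have "h - g \<in> hyp_tangent p"
      using h g by (simp add: hyp_tangent_iff lorentz_simps)
    moreover from this have "lorentz (h - g) (h - g) = 0"
      using h g(2)[of "h - g"] by (simp add: lorentz.diff_left)
    ultimately have "h - g = 0"
      by (rule lorentz_tangent_eq_0[OF p])
    then show "h = g"
      by simp
  qed (use g in auto)
  with g show "hyp_grad \<kappa> f p \<in> hyp_tangent p"
    "v \<in> hyp_tangent p \<Longrightarrow>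
      frechet_derivative f (at p within hyp_space \<kappa>) v = lorentz (hyp_grad \<kappa> f p) v"
    by (simp_all add: D_def)
qed

lemma DERIV_along_geodesic:
  assumes p: "p \<in> hyp_space \<kappa>" and v: "v \<in> hyp_tangent p" and f: "f differentiable_on hyp_space \<kappa>"
  defines "a \<equiv> sqrt \<kappa> * lnorm v"
  shows "((\<lambda>t. f (hyp_exp \<kappa> p (t *\<^sub>R v))) has_real_derivative
    lorentz (hyp_grad \<kappa> f (hyp_exp \<kappa> p (t *\<^sub>R v))) ((a * sinh (a * t)) *\<^sub>R p + cosh (a * t) *\<^sub>R v)) (at t)"
proof -
  define \<gamma> w where "\<gamma> s = hyp_exp \<kappa> p (s *\<^sub>R v)" and "w = (a * sinh (a * t)) *\<^sub>R p + cosh (a * t) *\<^sub>R v" for s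
  have H: "\<gamma> s \<in> hyp_space \<kappa>" for s
    unfolding \<gamma>_def by (intro hyp_exp_in p hyp_tangent_scaleR v)
  have der: "(\<gamma> has_vector_derivative w) (at t)"
    using hyp_exp_ray_has_vector_derivative[OF p v] by (simp add: \<gamma>_def[abs_def] w_def a_def)
  \<comment> \<open>Differentiating the constant \<open>lorentz (\<gamma> s) (\<gamma> s)\<close>
    shows that the velocity is tangent; only on tangent vectors does the gradient represent the
    derivative.\<close>
  have "((\<lambda>s. lorentz (\<gamma> s) (\<gamma> s)) has_vector_derivative lorentz (\<gamma> t) w + lorentz w (\<gamma> t)) (at t)"
    by (rule lorentz.has_vector_derivative[OF der der])
  moreover have "((\<lambda>s. lorentz (\<gamma> s) (\<gamma> s)) has_vector_derivative 0) (at t)"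
    using H by (simp add: hyp_space_iff)
  ultimately have "lorentz (\<gamma> t) w + lorentz w (\<gamma> t) = 0"
    by (rule vector_derivative_unique_at)
  then have w: "w \<in> hyp_tangent (\<gamma> t)"
    by (simp add: hyp_tangent_iff lorentz_commute[of w "\<gamma> t"])
  have diff: "f differentiable (at (\<gamma> t) within hyp_space \<kappa>)"
    using f H by (auto simp: differentiable_on_def)
  define D where "D = frechet_derivative f (at (\<gamma> t) within hyp_space \<kappa>)"
  have "(f has_derivative D) (at (\<gamma> t) within hyp_space \<kappa>)"
    unfolding D_def using diff by (simp add: frechet_derivative_works)
  then have "(f has_derivative D) (at (\<gamma> t) within range \<gamma>)"
    by (rule has_derivative_subset) (use H in auto)
  with der have "((\<lambda>s. f (\<gamma> s)) has_derivative (\<lambda>h. D (h *\<^sub>R w))) (at t)"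
    unfolding has_vector_derivative_def by (rule has_derivative_in_compose)
  moreover have "D (h *\<^sub>R w) = h * lorentz (hyp_grad \<kappa> f (\<gamma> t)) w" for h
    unfolding D_def using hyp_grad_props(2)[OF H diff hyp_tangent_scaleR[OF w]]
    by (simp add: lorentz.scaleR_right)
  ultimately show ?thesis
    unfolding \<gamma>_def w_def has_field_derivative_def by (simp add: mult_commute_abs)
qed

text \<open>By the mean value theorem the difference quotients of \<open>f\<close> are slopes at
  intermediate points and, by continuity of the gradient, tend to the limit slope. That slope is
  negative, hence strictly below its multiple by \<rho> < 1. Stated for moving base points and
  directions, it serves both termination and uniformity.\<close>

lemma armijo_eventually:
  assumes f: "f differentiable_on hyp_space \<kappa>" and cont: "continuous_on (hyp_space \<kappa>) (hyp_grad \<kappa> f)"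
    and xH: "\<And>j. x j \<in> hyp_space \<kappa>" and vT: "\<And>j. v j \<in> hyp_tangent (x j)"
    and x: "x \<longlonglongrightarrow> x'" "x' \<in> hyp_space \<kappa>" and v: "v \<longlonglongrightarrow> v'"
    and \<tau>: "\<And>j. \<tau> j > 0" "\<tau> \<longlonglongrightarrow> 0" and "\<rho> < 1" and neg: "lorentz (hyp_grad \<kappa> f x') v' < 0"
  shows "\<forall>\<^sub>F j in sequentially. f (hyp_exp \<kappa> (x j) (\<tau> j *\<^sub>R v j))
      \<le> f (x j) + \<rho> * \<tau> j * lorentz (hyp_grad \<kappa> f (x j)) (v j)"
proof -
  define a where "a j = sqrt \<kappa> * lnorm (v j)" for j
  define w where "w j t = (a j * sinh (a j * t)) *\<^sub>R x j + cosh (a j * t) *\<^sub>R v j" for j t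
  have "\<exists>\<xi>. 0 < \<xi> \<and> \<xi> < \<tau> j \<and> f (hyp_exp \<kappa> (x j) (\<tau> j *\<^sub>R v j)) - f (x j) =
      \<tau> j * lorentz (hyp_grad \<kappa> f (hyp_exp \<kappa> (x j) (\<xi> *\<^sub>R v j))) (w j \<xi>)" for j
    using MVT2[OF \<tau>(1)[of j] DERIV_along_geodesic[OF xH vT f]]
    by (simp add: hyp_exp_0 w_def a_def)
  then obtain \<xi> where \<xi>: "\<And>j. 0 < \<xi> j" "\<And>j. \<xi> j < \<tau> j"
    and mvt: "\<And>j. f (hyp_exp \<kappa> (x j) (\<tau> j *\<^sub>R v j)) - f (x j) =
      \<tau> j * lorentz (hyp_grad \<kappa> f (hyp_exp \<kappa> (x j) (\<xi> j *\<^sub>R v j))) (w j (\<xi> j))"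
    by metis
  have \<xi>0: "\<xi> \<longlonglongrightarrow> 0"
    using \<xi> by (intro tendsto_sandwich[OF _ _ tendsto_const \<tau>(2)] always_eventually)
      (auto intro: less_imp_le)
  have "(\<lambda>j. \<xi> j *\<^sub>R v j) \<longlonglongrightarrow> 0 *\<^sub>R v'"
    by (intro tendsto_intros \<xi>0 v)
  then have "(\<lambda>j. hyp_exp \<kappa> (x j) (\<xi> j *\<^sub>R v j)) \<longlonglongrightarrow> hyp_exp \<kappa> x' 0"
    by (intro tendsto_hyp_exp xH hyp_tangent_scaleR vT x zero_tangent) simp
  then have g1: "(\<lambda>j. hyp_grad \<kappa> f (hyp_exp \<kappa> (x j) (\<xi> j *\<^sub>R v j))) \<longlonglongrightarrow> hyp_grad \<kappa> f x'"
    unfolding hyp_exp_0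
    by (rule continuous_on_tendsto_compose[OF cont])
       (auto intro!: x always_eventually hyp_exp_in xH hyp_tangent_scaleR vT)
  have g2: "(\<lambda>j. hyp_grad \<kappa> f (x j)) \<longlonglongrightarrow> hyp_grad \<kappa> f x'"
    by (rule continuous_on_tendsto_compose[OF cont]) (auto intro!: x always_eventually xH)
  have "a \<longlonglongrightarrow> sqrt \<kappa> * lnorm v'"
    unfolding a_def by (intro tendsto_intros v)
  then have "(\<lambda>j. w j (\<xi> j)) \<longlonglongrightarrow> (sqrt \<kappa> * lnorm v' * sinh (sqrt \<kappa> * lnorm v' * 0)) *\<^sub>R x'
      + cosh (sqrt \<kappa> * lnorm v' * 0) *\<^sub>R v'"
    unfolding w_def by (intro tendsto_intros v \<xi>0 x)
  then have "(\<lambda>j. w j (\<xi> j)) \<longlonglongrightarrow> v'"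
    by simp
  then have "(\<lambda>j. lorentz (hyp_grad \<kappa> f (hyp_exp \<kappa> (x j) (\<xi> j *\<^sub>R v j))) (w j (\<xi> j))
      - \<rho> * lorentz (hyp_grad \<kappa> f (x j)) (v j))
    \<longlonglongrightarrow> lorentz (hyp_grad \<kappa> f x') v' - \<rho> * lorentz (hyp_grad \<kappa> f x') v'"
    by (intro tendsto_intros lorentz.tendsto g1 g2 v)
  moreover have "lorentz (hyp_grad \<kappa> f x') v' - \<rho> * lorentz (hyp_grad \<kappa> f x') v'
      = (1 - \<rho>) * lorentz (hyp_grad \<kappa> f x') v'"
    by (simp add: algebra_simps)
  moreover have "\<dots> < 0"
    using neg \<open>\<rho> < 1\<close> by (simp add: mult_less_0_iff)
  ultimately have "\<forall>\<^sub>F j in sequentially.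
      lorentz (hyp_grad \<kappa> f (hyp_exp \<kappa> (x j) (\<xi> j *\<^sub>R v j))) (w j (\<xi> j))
      - \<rho> * lorentz (hyp_grad \<kappa> f (x j)) (v j) < 0"
    by (intro order_tendstoD) auto
  then show ?thesis
  proof eventually_elim
    case (elim j)
    then have "\<tau> j * lorentz (hyp_grad \<kappa> f (hyp_exp \<kappa> (x j) (\<xi> j *\<^sub>R v j))) (w j (\<xi> j))
        \<le> \<tau> j * (\<rho> * lorentz (hyp_grad \<kappa> f (x j)) (v j))"
      using \<tau>(1)[of j] by (intro mult_left_mono) auto
    then show ?case
      using mvt[of j] by (simp add: algebra_simps)
  qed
qed

end

subsection \<open>The gradient projection step and the line search\<close>

locale gradient_projection = hyperbolic_space +
  fixes C :: "((real^'n) \<times> real) set" and f :: "(real^'n) \<times> real \<Rightarrow> real"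
    and \<rho> \<alpha>lo \<alpha>hi :: real
  assumes C: "C \<subseteq> hyp_space \<kappa>" "closed C" "hyp_convex \<kappa> C"
    and diff: "f differentiable_on hyp_space \<kappa>"
    and cont_grad: "continuous_on (hyp_space \<kappa>) (hyp_grad \<kappa> f)"
    and rho: "0 < \<rho>" "\<rho> < 1" and alpha: "0 < \<alpha>lo" "0 < \<alpha>hi"
begin

text \<open>Takes the step parameter as an argument because limits are taken in it and in the point
  jointly.\<close>

definition direction :: "real \<Rightarrow> (real^'n) \<times> real \<Rightarrow> (real^'n) \<times> real" where
  "direction \<alpha> x = hyp_log \<kappa> x (hyp_proj \<kappa> C (hyp_exp \<kappa> x (- \<alpha> *\<^sub>R hyp_grad \<kappa> f x)))"

lemma CH: "x \<in> C \<Longrightarrow> x \<in> hyp_space \<kappa>"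
  using C(1) by auto

lemma grad_tangent: "x \<in> hyp_space \<kappa> \<Longrightarrow> hyp_grad \<kappa> f x \<in> hyp_tangent x"
  using diff by (intro hyp_grad_props) (auto simp: differentiable_on_def)

context
  fixes \<alpha> :: real and x :: "(real^'n) \<times> real"
  assumes \<alpha>: "\<alpha> > 0" and x: "x \<in> C"
begin

lemma neg_grad_tangent: "- \<alpha> *\<^sub>R hyp_grad \<kappa> f x \<in> hyp_tangent x"
  by (intro hyp_tangent_scaleR grad_tangent CH x)

lemma direction_tangent: "direction \<alpha> x \<in> hyp_tangent x"
  unfolding direction_def by (intro hyp_log_tangent CH x)

lemma
  shows exp_direction: "hyp_exp \<kappa> x (direction \<alpha> x) = hyp_proj \<kappa> C (hyp_exp \<kappa> x (- \<alpha> *\<^sub>R hyp_grad \<kappa> f x))"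
    and exp_direction_in: "hyp_exp \<kappa> x (direction \<alpha> x) \<in> C"
    and exp_direction_variational: "q \<in> C \<Longrightarrow> lorentz (hyp_exp \<kappa> x (- \<alpha> *\<^sub>R hyp_grad \<kappa> f x))
      (tangent_part \<kappa> (hyp_exp \<kappa> x (direction \<alpha> x)) q) \<le> 0"
proof -
  have "C \<noteq> {}"
    using x by blast
  note proj = hyp_proj_props[OF C(1,2) this C(3) hyp_exp_in[OF CH[OF x] neg_grad_tangent]]
  show eq: "hyp_exp \<kappa> x (direction \<alpha> x) = hyp_proj \<kappa> C (hyp_exp \<kappa> x (- \<alpha> *\<^sub>R hyp_grad \<kappa> f x))"
    unfolding direction_def by (rule hyp_exp_log[OF CH[OF x] CH[OF proj(1)]])
  show "hyp_exp \<kappa> x (direction \<alpha> x) \<in> C"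
    unfolding eq by (rule proj(1))
  show "q \<in> C \<Longrightarrow> lorentz (hyp_exp \<kappa> x (- \<alpha> *\<^sub>R hyp_grad \<kappa> f x))
      (tangent_part \<kappa> (hyp_exp \<kappa> x (direction \<alpha> x)) q) \<le> 0"
    unfolding eq by (rule proj(2))
qed

lemma exp_scaleR_direction_in:
  assumes "0 \<le> t" "t \<le> 1"
  shows "hyp_exp \<kappa> x (t *\<^sub>R direction \<alpha> x) \<in> C"
proof -
  have "direction \<alpha> x = hyp_log \<kappa> x (hyp_exp \<kappa> x (direction \<alpha> x))"
    unfolding exp_direction by (simp only: direction_def)
  then show ?thesis
    using convexD_geodesic[OF C(3) x exp_direction_in assms] by simp
qed

text \<open>The current point \<open>x\<close> belongs to \<open>C\<close>, so it is an admissible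
  test point in the variational inequality at the projection.\<close>

lemma direction_descent:
  "lorentz (direction \<alpha> x) (direction \<alpha> x) \<le> - \<alpha> * lorentz (hyp_grad \<kappa> f x) (direction \<alpha> x)"
  using projection_direction[OF CH[OF x] neg_grad_tangent direction_tangent exp_direction_variational[OF x]]
  by (simp add: lorentz_simps)

lemma lnorm_direction_le: "lnorm (direction \<alpha> x) \<le> \<alpha> * lnorm (hyp_grad \<kappa> f x)"
proof (cases "lnorm (direction \<alpha> x) = 0")
  case True
  then show ?thesis
    using lnorm_nonneg[OF CH[OF x] grad_tangent[OF CH[OF x]]] \<alpha> by simp
next
  case False
  then have pos: "lnorm (direction \<alpha> x) > 0"
    using lnorm_nonneg[OF CH[OF x] direction_tangent] by simp
  have "lnorm (direction \<alpha> x) * lnorm (direction \<alpha> x) \<le> lorentz (- \<alpha> *\<^sub>R hyp_grad \<kappa> f x) (direction \<alpha> x)"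
    using direction_descent lnorm_power2[OF CH[OF x] direction_tangent]
    by (simp add: power2_eq_square lorentz_simps)
  also have "\<dots> \<le> lnorm (- \<alpha> *\<^sub>R hyp_grad \<kappa> f x) * lnorm (direction \<alpha> x)"
    by (rule lorentz_tangent_le[OF CH[OF x] neg_grad_tangent direction_tangent])
  finally show ?thesis
    using pos \<alpha> unfolding lnorm_scaleR by simp
qed

end

text \<open>If the limit slope were nonnegative, \<open>direction_descent\<close> in the limit would
  force \<open>v = 0\<close>. The projected points would then also tend to \<open>x'\<close>, and
  their variational inequalities would pass to the limit and make \<open>x'\<close>
  stationary.\<close>

lemma direction_limit:
  assumes x: "\<And>j. x j \<in> C" "x \<longlonglongrightarrow> x'" and a: "\<And>j. \<alpha>lo \<le> a j" "\<And>j. a j \<le> \<alpha>hi"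
    and x': "x' \<in> C" and ns: "\<not> hyp_stationary \<kappa> f C x'"
  obtains r v where "strict_mono r" "(\<lambda>j. direction (a (r j)) (x (r j))) \<longlonglongrightarrow> v"
    "lorentz (hyp_grad \<kappa> f x') v < 0"
proof -
  have a0: "a j > 0" for j
    using alpha(1) a(1)[of j] by linarith
  define d where "d j = direction (a j) (x j)" for j
  have g: "(\<lambda>j. hyp_grad \<kappa> f (x j)) \<longlonglongrightarrow> hyp_grad \<kappa> f x'"
    by (rule continuous_on_tendsto_compose[OF cont_grad])
       (auto intro!: x always_eventually CH x')
  define M where "M j = sqrt (2 * \<kappa>) * snd (x j) * (\<alpha>hi * lnorm (hyp_grad \<kappa> f (x j)))" for j
  have "convergent M"
    unfolding M_def by (rule convergentI) (rule tendsto_intros g x)+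
  then obtain B where B: "\<And>j. norm (M j) \<le> B"
    using convergent_imp_Bseq Bseq_def by metis
  have dB: "norm (d j) \<le> B" for j
  proof -
    have "norm (d j) \<le> sqrt (2 * \<kappa>) * snd (x j) * lnorm (d j)"
      unfolding d_def by (intro norm_le_lnorm CH x direction_tangent a0)
    also have "lnorm (d j) \<le> a j * lnorm (hyp_grad \<kappa> f (x j))"
      unfolding d_def by (intro lnorm_direction_le x a0)
    also have "\<dots> \<le> \<alpha>hi * lnorm (hyp_grad \<kappa> f (x j))"
      using lnorm_nonneg[OF CH[OF x(1)] grad_tangent[OF CH[OF x(1)]]] a by (intro mult_right_mono)
    finally have "norm (d j) \<le> M j"
      using CH[OF x(1)[of j]] kappa by (simp add: M_def hyp_space_iff mult_left_mono)
    then show ?thesis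
      using B[of j] by simp
  qed
  \<comment> \<open>Parameters and directions are made to converge along one common subsequence; the
    limit parameter stays at least \<open>\<alpha>lo\<close>, hence positive.\<close>
  have "bounded (range (\<lambda>j. (a j, d j)))"
  proof (rule boundedI)
    fix y assume "y \<in> range (\<lambda>j. (a j, d j))"
    then obtain j where y: "y = (a j, d j)"
      by blast
    have "norm y \<le> norm (a j) + norm (d j)"
      unfolding y by (rule norm_Pair_le)
    also have "\<dots> \<le> \<alpha>hi + B"
      using a0[of j] a(2)[of j] dB[of j] by simp
    finally show "norm y \<le> \<alpha>hi + B" .
  qed
  then obtain l r where r: "strict_mono r" and l: "((\<lambda>j. (a j, d j)) \<circ> r) \<longlonglongrightarrow> l"
    using bounded_imp_convergent_subsequence by blast
  define a' v where "a' = fst l" and "v = snd l"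
  have al: "(\<lambda>j. a (r j)) \<longlonglongrightarrow> a'" and vl: "(\<lambda>j. d (r j)) \<longlonglongrightarrow> v"
    using tendsto_fst[OF l] tendsto_snd[OF l] by (simp_all add: a'_def v_def o_def)
  have xl: "(\<lambda>j. x (r j)) \<longlonglongrightarrow> x'" and gl: "(\<lambda>j. hyp_grad \<kappa> f (x (r j))) \<longlonglongrightarrow> hyp_grad \<kappa> f x'"
    using LIMSEQ_subseq_LIMSEQ[OF x(2) r] LIMSEQ_subseq_LIMSEQ[OF g r] by (simp_all add: o_def)
  have a': "a' \<ge> \<alpha>lo"
    by (rule LIMSEQ_le_const[OF al]) (use a in auto)
  have vT: "v \<in> hyp_tangent x'"
  proof -
    have "(\<lambda>j. lorentz (x (r j)) (d (r j))) \<longlonglongrightarrow> lorentz x' v"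
      by (intro lorentz.tendsto xl vl)
    moreover have "lorentz (x (r j)) (d (r j)) = 0" for j
      using direction_tangent[OF a0 x(1)] by (simp add: d_def hyp_tangent_iff)
    ultimately show ?thesis
      by (simp add: hyp_tangent_iff LIMSEQ_const_iff)
  qed
  have "lorentz (hyp_grad \<kappa> f x') v < 0"
  proof (rule ccontr)
    assume nonneg: "\<not> ?thesis"
    have "lorentz v v \<le> - a' * lorentz (hyp_grad \<kappa> f x') v"
    proof (rule LIMSEQ_le)
      show "(\<lambda>j. lorentz (d (r j)) (d (r j))) \<longlonglongrightarrow> lorentz v v"
        by (intro lorentz.tendsto vl)
      show "(\<lambda>j. - a (r j) * lorentz (hyp_grad \<kappa> f (x (r j))) (d (r j)))
          \<longlonglongrightarrow> - a' * lorentz (hyp_grad \<kappa> f x') v"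
        by (intro tendsto_intros lorentz.tendsto vl gl al)
      show "\<exists>N. \<forall>n\<ge>N. lorentz (d (r n)) (d (r n)) \<le> - a (r n) * lorentz (hyp_grad \<kappa> f (x (r n))) (d (r n))"
        using direction_descent[OF a0 x(1)] by (auto simp: d_def)
    qed
    also have "\<dots> \<le> 0"
      using nonneg a' alpha(1) by (simp add: mult_le_0_iff)
    finally have "v = 0"
      using lorentz_tangent_nonneg[OF CH[OF x'] vT] lorentz_tangent_eq_0[OF CH[OF x'] vT] by simp
    have zl: "(\<lambda>j. hyp_exp \<kappa> (x (r j)) (d (r j))) \<longlonglongrightarrow> x'"
      using tendsto_hyp_exp[OF CH[OF x(1)] direction_tangent[OF a0 x(1)] xl CH[OF x'] vl[unfolded d_def] vT]
      by (simp add: d_def \<open>v = 0\<close> hyp_exp_0)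
    have yl: "(\<lambda>j. hyp_exp \<kappa> (x (r j)) (- a (r j) *\<^sub>R hyp_grad \<kappa> f (x (r j))))
        \<longlonglongrightarrow> hyp_exp \<kappa> x' (- a' *\<^sub>R hyp_grad \<kappa> f x')"
      by (intro tendsto_hyp_exp CH x neg_grad_tangent a0 xl x' hyp_tangent_scaleR grad_tangent
        tendsto_intros al gl)
    have "lorentz (hyp_grad \<kappa> f x') q \<ge> 0" if q: "q \<in> C" for q
    proof -
      have "lorentz (hyp_exp \<kappa> x' (- a' *\<^sub>R hyp_grad \<kappa> f x')) (tangent_part \<kappa> x' q) \<le> 0"
      proof (rule Lim_bounded)
        show "(\<lambda>j. lorentz (hyp_exp \<kappa> (x (r j)) (- a (r j) *\<^sub>R hyp_grad \<kappa> f (x (r j))))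
            (tangent_part \<kappa> (hyp_exp \<kappa> (x (r j)) (d (r j))) q))
          \<longlonglongrightarrow> lorentz (hyp_exp \<kappa> x' (- a' *\<^sub>R hyp_grad \<kappa> f x')) (tangent_part \<kappa> x' q)"
          unfolding tangent_part_def by (intro lorentz.tendsto tendsto_intros yl zl)
        show "\<forall>j\<ge>0. lorentz (hyp_exp \<kappa> (x (r j)) (- a (r j) *\<^sub>R hyp_grad \<kappa> f (x (r j))))
            (tangent_part \<kappa> (hyp_exp \<kappa> (x (r j)) (d (r j))) q) \<le> 0"
          using exp_direction_variational[OF a0 x(1) q] by (simp add: d_def)
      qed
      then have "lorentz (- a' *\<^sub>R hyp_grad \<kappa> f x') q \<le> 0"
        by (rule lorentz_le_0_if_exp_variational[OF CH[OF x'] hyp_tangent_scaleR[OF grad_tangent[OF CH[OF x']]]])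
      then show ?thesis
        using a' alpha(1) by (simp add: lorentz_simps zero_le_mult_iff)
    qed
    with ns x' show False
      by (simp add: hyp_stationary_def)
  qed
  with r vl show thesis
    by (intro that[of r v]) (simp_all add: d_def)
qed

section \<open>Sufficient decrease near a non-stationary point, and termination\<close>

definition armijo :: "real \<Rightarrow> (real^'n) \<times> real \<Rightarrow> real \<Rightarrow> bool" where
  "armijo \<alpha> x \<tau> \<longleftrightarrow> f (hyp_exp \<kappa> x (\<tau> *\<^sub>R direction \<alpha> x))
    \<le> f x + \<rho> * \<tau> * lorentz (hyp_grad \<kappa> f x) (direction \<alpha> x)"

text \<open>One number can serve as radius, descent rate and step threshold, since shrinking it
  weakens all three demands. If every e = 1 / (j + 1) failed, the counterexamples would converge to
  \<open>x'\<close> with vanishing steps, contradicting \<open>direction_limit\<close> and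
  \<open>armijo_eventually\<close> along a subsequence.\<close>

lemma uniform_armijo:
  assumes x': "x' \<in> C" and ns: "\<not> hyp_stationary \<kappa> f C x'"
  obtains e where "0 < e" "e \<le> 1"
    "\<And>x \<alpha>. x \<in> C \<Longrightarrow> \<alpha>lo \<le> \<alpha> \<Longrightarrow> \<alpha> \<le> \<alpha>hi \<Longrightarrow> hyp_dist \<kappa> x' x < e \<Longrightarrow>
      lorentz (hyp_grad \<kappa> f x) (direction \<alpha> x) \<le> - e"
    "\<And>x \<alpha> \<tau>. x \<in> C \<Longrightarrow> \<alpha>lo \<le> \<alpha> \<Longrightarrow> \<alpha> \<le> \<alpha>hi \<Longrightarrow> hyp_dist \<kappa> x' x < e \<Longrightarrow>
      0 < \<tau> \<Longrightarrow> \<tau> \<le> e \<Longrightarrow> armijo \<alpha> x \<tau>"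
proof -
  define good where "good e x \<alpha> \<tau> \<longleftrightarrow> lorentz (hyp_grad \<kappa> f x) (direction \<alpha> x) \<le> - e \<and> armijo \<alpha> x \<tau>"
    for e x \<alpha> \<tau>
  have "\<exists>e>0. e \<le> 1 \<and> (\<forall>x\<in>C. \<forall>\<alpha> \<tau>. \<alpha>lo \<le> \<alpha> \<and> \<alpha> \<le> \<alpha>hi \<and> hyp_dist \<kappa> x' x < e \<and> 0 < \<tau> \<and> \<tau> \<le> e
      \<longrightarrow> good e x \<alpha> \<tau>)"
  proof (rule ccontr)
    assume contra: "\<not> ?thesis"
    define e where "e j = inverse (real (Suc j))" for j
    have e: "e j > 0" "e j \<le> 1" for j
      by (auto simp: e_def inverse_le_1_iff)
    have elim: "e \<longlonglongrightarrow> 0"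
      unfolding e_def by (rule LIMSEQ_inverse_real_of_nat)
    have "\<exists>x \<alpha> \<tau>. x \<in> C \<and> \<alpha>lo \<le> \<alpha> \<and> \<alpha> \<le> \<alpha>hi \<and> hyp_dist \<kappa> x' x < e j \<and> 0 < \<tau> \<and> \<tau> \<le> e j
        \<and> \<not> good (e j) x \<alpha> \<tau>" for j
      using contra e[of j] by blast
    then obtain x a \<tau> where x: "\<And>j. x j \<in> C" and a: "\<And>j. \<alpha>lo \<le> a j" "\<And>j. a j \<le> \<alpha>hi"
      and d: "\<And>j. hyp_dist \<kappa> x' (x j) < e j" and \<tau>: "\<And>j. 0 < \<tau> j" "\<And>j. \<tau> j \<le> e j"
      and bad: "\<And>j. \<not> good (e j) (x j) (a j) (\<tau> j)"
      by metis
    have a0: "a j > 0" for j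
      using alpha(1) a(1)[of j] by linarith
    have "(\<lambda>j. hyp_dist \<kappa> x' (x j)) \<longlonglongrightarrow> 0"
      using d hyp_dist_nonneg[OF CH[OF x'] CH[OF x]]
      by (intro tendsto_sandwich[OF _ _ tendsto_const elim] always_eventually) (auto intro: less_imp_le)
    then have xl: "x \<longlonglongrightarrow> x'"
      by (intro tendsto_if_hyp_dist CH x x')
    obtain r v where r: "strict_mono r" and v: "(\<lambda>j. direction (a (r j)) (x (r j))) \<longlonglongrightarrow> v"
      and neg: "lorentz (hyp_grad \<kappa> f x') v < 0"
      using direction_limit[OF x xl a x' ns] .
    have \<tau>l: "\<tau> \<longlonglongrightarrow> 0"
      using \<tau> by (intro tendsto_sandwich[OF _ _ tendsto_const elim] always_eventually) (auto intro: less_imp_le)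
    have sub: "(\<lambda>j. x (r j)) \<longlonglongrightarrow> x'" "(\<lambda>j. \<tau> (r j)) \<longlonglongrightarrow> 0" "(\<lambda>j. e (r j)) \<longlonglongrightarrow> 0"
      using LIMSEQ_subseq_LIMSEQ[OF xl r] LIMSEQ_subseq_LIMSEQ[OF \<tau>l r] LIMSEQ_subseq_LIMSEQ[OF elim r]
      by (simp_all add: o_def)
    have "\<forall>\<^sub>F j in sequentially. armijo (a (r j)) (x (r j)) (\<tau> (r j))"
      unfolding armijo_def
      by (rule armijo_eventually[OF diff cont_grad CH[OF x] direction_tangent[OF a0 x] sub(1) CH[OF x'] v
        \<tau>(1) sub(2) rho(2) neg])
    moreover have "\<forall>\<^sub>F j in sequentially.
        lorentz (hyp_grad \<kappa> f (x (r j))) (direction (a (r j)) (x (r j))) + e (r j) < 0"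
    proof (rule order_tendstoD)
      have "(\<lambda>j. hyp_grad \<kappa> f (x (r j))) \<longlonglongrightarrow> hyp_grad \<kappa> f x'"
        by (rule continuous_on_tendsto_compose[OF cont_grad])
           (auto intro!: sub always_eventually CH x' x)
      then show "(\<lambda>j. lorentz (hyp_grad \<kappa> f (x (r j))) (direction (a (r j)) (x (r j))) + e (r j))
          \<longlonglongrightarrow> lorentz (hyp_grad \<kappa> f x') v + 0"
        by (intro tendsto_intros lorentz.tendsto v sub)
    qed (use neg in simp)
    ultimately have "\<forall>\<^sub>F j in sequentially. False"
    proof eventually_elim
      case (elim j)
      then show False
        using bad[of "r j"] by (simp add: good_def)
    qed
    then show False
      by simp
  qed
  then obtain e where e: "e > 0" "e \<le> 1"
    and good: "\<And>x \<alpha> \<tau>. x \<in> C \<Longrightarrow> \<alpha>lo \<le> \<alpha> \<Longrightarrow> \<alpha> \<le> \<alpha>hi \<Longrightarrow> hyp_dist \<kappa> x' x < e \<Longrightarrow> 0 < \<tau> \<Longrightarrow> \<tau> \<le> e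
      \<Longrightarrow> good e x \<alpha> \<tau>"
    by metis
  from e show thesis
  proof (rule that)
    fix x \<alpha> \<tau> assume "x \<in> C" "\<alpha>lo \<le> \<alpha>" "\<alpha> \<le> \<alpha>hi" "hyp_dist \<kappa> x' x < e"
    note * = good[OF this]
    \<comment> \<open>The rate does not involve the step, so any admissible step, here
      \<open>\<tau> = e\<close>, will do.\<close>
    show "lorentz (hyp_grad \<kappa> f x) (direction \<alpha> x) \<le> - e"
      using *[of e] e by (simp add: good_def)
    show "armijo \<alpha> x \<tau>" if "0 < \<tau>" "\<tau> \<le> e"
      using *[OF that] by (simp add: good_def)
  qed
qed

text \<open>Ensures that the \<open>LEAST\<close> of the line search is attained. A zero direction
  passes the test with equality; any other has negative slope, and \<open>armijo_eventually\<close>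
  applies with constant point and direction.\<close>

lemma armijo_terminates:
  assumes x: "x \<in> C" and a: "0 < a" and \<beta>: "0 < \<beta>" "\<beta> < 1" and \<theta>: "0 < \<theta>"
  shows "\<exists>l. \<beta> ^ l * \<theta> \<in> {0..1} \<and> armijo a x (\<beta> ^ l * \<theta>)"
proof -
  have lim: "(\<lambda>l. \<beta> ^ l * \<theta>) \<longlonglongrightarrow> 0"
    using \<beta> by (intro tendsto_mult_left_zero LIMSEQ_realpow_zero) auto
  then have "\<forall>\<^sub>F l in sequentially. \<beta> ^ l * \<theta> < 1"
    by (rule order_tendstoD) simp
  moreover have "\<forall>\<^sub>F l in sequentially. armijo a x (\<beta> ^ l * \<theta>)"
  proof (cases "direction a x = 0")
    case True
    then show ?thesis
      by (simp add: armijo_def lorentz_simps hyp_exp_0)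
  next
    case False
    then have "lorentz (direction a x) (direction a x) > 0"
      using lorentz_tangent_nonneg[OF CH[OF x] direction_tangent[OF a x]]
        lorentz_tangent_eq_0[OF CH[OF x] direction_tangent[OF a x]] by fastforce
    then have "0 < - a * lorentz (hyp_grad \<kappa> f x) (direction a x)"
      using direction_descent[OF a x] by linarith
    then have "lorentz (hyp_grad \<kappa> f x) (direction a x) < 0"
      using a by (simp add: mult_less_0_iff)
    then show ?thesis
      unfolding armijo_def using \<beta> \<theta>
      by (intro armijo_eventually[OF diff cont_grad _ _ tendsto_const _ tendsto_const _ lim rho(2)])
         (auto intro: CH x direction_tangent[OF a x])
  qed
  ultimately have "\<forall>\<^sub>F l in sequentially. \<beta> ^ l * \<theta> \<in> {0..1} \<and> armijo a x (\<beta> ^ l * \<theta>)"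
    by eventually_elim (use \<beta> \<theta> in auto)
  then show ?thesis
    by (rule eventually_happens'[OF sequentially_bot])
qed

subsection \<open>Backtracking\<close>

text \<open>
  Since the displacement of the \<open>k\<close>-th step is at most \<open>sqrt (K * s k)\<close> and \<open>s k = \<beta> * s (Suc k)\<close>
  whenever the following step is a first trial, \<open>hyp_dist \<kappa> pbar (p k) + A * sqrt (s k)\<close> does not
  increase backwards in time along first trials, for \<open>A\<close> with \<open>sqrt K * sqrt \<beta> + A * sqrt \<beta> = A\<close>.
\<close>
lemma cluster_point_stationary:
  fixes p :: "nat \<Rightarrow> (real^'n) \<times> real" and \<alpha> \<theta> :: "nat \<Rightarrow> real" and L :: "nat \<Rightarrow> nat"
  assumes bdd: "bdd_below (f ` C)" and \<beta>: "0 < \<beta>" "\<beta> < 1" and p0: "p 0 \<in> C" and \<theta>0: "0 < \<theta> 0"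
    and \<alpha>: "\<And>k. \<alpha>lo \<le> \<alpha> k" "\<And>k. \<alpha> k \<le> \<alpha>hi"
    and L: "\<And>k. L k = (LEAST l. \<beta> ^ l * \<theta> k \<in> {0..1} \<and> armijo (\<alpha> k) (p k) (\<beta> ^ l * \<theta> k))"
    and p_Suc: "\<And>k. p (Suc k) = hyp_exp \<kappa> (p k) ((\<beta> ^ L k * \<theta> k) *\<^sub>R direction (\<alpha> k) (p k))"
    and \<theta>_Suc: "\<And>k. \<theta> (Suc k) = \<beta> powi (int (L k) - 1) * \<theta> k"
    and pbar: "pbar \<in> C" and cluster: "cluster_point p pbar"
  shows "hyp_stationary \<kappa> f C pbar"
proof (rule ccontr)
  assume ns: "\<not> ?thesis"
  define s where "s k = \<beta> ^ L k * \<theta> k" for k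
  define D where "D k = - lorentz (hyp_grad \<kappa> f (p k)) (direction (\<alpha> k) (p k))" for k
  have \<alpha>0: "\<alpha> k > 0" for k
    using alpha(1) \<alpha>(1)[of k] by linarith
  have \<theta>_s: "\<theta> (Suc k) = s k / \<beta>" for k
    using \<beta> by (simp add: \<theta>_Suc s_def power_int_diff)
  have step: "s k > 0 \<and> s k \<le> 1 \<and> armijo (\<alpha> k) (p k) (s k)" if "p k \<in> C" "\<theta> k > 0" for k
    using LeastI_ex[OF armijo_terminates[OF that(1) \<alpha>0[of k] \<beta> that(2)]] that \<beta>
    unfolding L[symmetric] s_def by simp
  \<comment> \<open>Both facts are carried together: each is needed for the line search to
    terminate, and the accepted step yields both at the next index.\<close>
  have inv: "p k \<in> C \<and> \<theta> k > 0" for k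
  proof (induction k)
    case (Suc k)
    then show ?case
      using step[of k] exp_scaleR_direction_in[OF \<alpha>0, of "p k" "s k" k] \<beta>
      by (simp add: p_Suc \<theta>_s flip: s_def)
  qed (simp add: p0 \<theta>0)
  then have pC: "p k \<in> C" and s: "s k > 0" "s k \<le> 1" and arm: "armijo (\<alpha> k) (p k) (s k)" for k
    using step by auto
  note pH = CH[OF pC] and vT = direction_tangent[OF \<alpha>0 pC]
  have vD: "lorentz (direction (\<alpha> k) (p k)) (direction (\<alpha> k) (p k)) \<le> \<alpha> k * D k" for k
    using direction_descent[OF \<alpha>0 pC] by (simp add: D_def)
  have D0: "D k \<ge> 0" for k
    using order_trans[OF lorentz_tangent_nonneg[OF pH vT] vD[of k]] \<alpha>0[of k]
    by (simp add: zero_le_mult_iff)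
  have decrease: "\<rho> * (s k * D k) \<le> f (p k) - f (p (Suc k))" for k
    using arm[of k] by (simp add: armijo_def p_Suc D_def flip: s_def)
  then have dec: "decseq (\<lambda>k. f (p k))"
    using rho(1) s D0 by (intro decseq_SucI) (smt (verit) mult_nonneg_nonneg)
  obtain m where m: "\<And>q. q \<in> C \<Longrightarrow> m \<le> f q"
    using bdd by (auto simp: bdd_below_def)
  \<comment> \<open>The factor after \<open>\<alpha>hi\<close> bounds every product
    \<open>s k * D k\<close>, since a single decrease cannot exceed the total one.\<close>
  define K where "K = \<alpha>hi * ((f (p 0) - m) / \<rho>)"
  have displacement: "hyp_dist \<kappa> (p k) (p (Suc k)) \<le> sqrt K * sqrt (s k)" for k
  proof -
    have "\<rho> * (s k * D k) \<le> f (p 0) - m"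
      using decrease[of k] decseqD[OF dec, of 0 k] m[OF pC[of "Suc k"]] by simp
    then have sD: "s k * D k \<le> (f (p 0) - m) / \<rho>"
      using rho(1) by (simp add: field_simps)
    have "(hyp_dist \<kappa> (p k) (p (Suc k)))\<^sup>2 = (s k)\<^sup>2 * (lnorm (direction (\<alpha> k) (p k)))\<^sup>2"
      unfolding p_Suc s_def[symmetric] hyp_dist_exp[OF pH hyp_tangent_scaleR[OF vT]] lnorm_scaleR
      by (simp add: power_mult_distrib)
    also have "\<dots> \<le> (s k)\<^sup>2 * (\<alpha>hi * D k)"
      unfolding lnorm_power2[OF pH vT]
      using order_trans[OF vD mult_right_mono[OF \<alpha>(2) D0]] by (intro mult_left_mono) auto
    also have "\<dots> = s k * \<alpha>hi * (s k * D k)"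
      by (simp add: power2_eq_square)
    also have "\<dots> \<le> s k * \<alpha>hi * ((f (p 0) - m) / \<rho>)"
      using s[of k] alpha(2) by (intro mult_left_mono sD) auto
    also have "\<dots> = K * s k"
      by (simp add: K_def)
    finally show ?thesis
      unfolding real_sqrt_mult[symmetric] by (rule real_le_rsqrt)
  qed
  obtain e where e: "0 < e" "e \<le> 1"
    and De: "\<And>k. hyp_dist \<kappa> pbar (p k) < e \<Longrightarrow> e \<le> D k"
    and arm_e: "\<And>k \<tau>. hyp_dist \<kappa> pbar (p k) < e \<Longrightarrow> 0 < \<tau> \<Longrightarrow> \<tau> \<le> e \<Longrightarrow> armijo (\<alpha> k) (p k) \<tau>"
  proof -
    obtain e where "0 < e" "e \<le> 1"
      "\<And>x \<alpha>. x \<in> C \<Longrightarrow> \<alpha>lo \<le> \<alpha> \<Longrightarrow> \<alpha> \<le> \<alpha>hi \<Longrightarrow> hyp_dist \<kappa> pbar x < e \<Longrightarrow>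
        lorentz (hyp_grad \<kappa> f x) (direction \<alpha> x) \<le> - e"
      "\<And>x \<alpha> \<tau>. x \<in> C \<Longrightarrow> \<alpha>lo \<le> \<alpha> \<Longrightarrow> \<alpha> \<le> \<alpha>hi \<Longrightarrow> hyp_dist \<kappa> pbar x < e \<Longrightarrow>
        0 < \<tau> \<Longrightarrow> \<tau> \<le> e \<Longrightarrow> armijo \<alpha> x \<tau>"
      using uniform_armijo[OF pbar ns] by blast
    note e = this
    show thesis
    proof (rule that[of e])
      show "e \<le> D k" if "hyp_dist \<kappa> pbar (p k) < e" for k
        using e(3)[OF pC \<alpha>(1,2)[of k] that] by (simp add: D_def)
      show "armijo (\<alpha> k) (p k) \<tau>" if "hyp_dist \<kappa> pbar (p k) < e" "0 < \<tau>" "\<tau> \<le> e" for k \<tau>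
        using e(4)[OF pC \<alpha> that] .
    qed (use e in auto)
  qed
  \<comment> \<open>If some trial was rejected, the last rejected one is
    \<open>s k / \<beta>\<close>. The margin \<beta> puts it below \<open>e\<close>, where the test
    succeeds, and \<open>e \<le> 1\<close> makes it admissible in {0..1}.\<close>
  have first_trial: "s k = \<theta> k" if "hyp_dist \<kappa> pbar (p k) < e" "s k < \<beta> * e" for k
  proof (cases "L k")
    case 0
    then show ?thesis
      by (simp add: s_def)
  next
    case (Suc l)
    define \<tau> where "\<tau> = \<beta> ^ l * \<theta> k"
    have "\<beta> * \<tau> < \<beta> * e"
      using that(2) by (simp add: s_def Suc \<tau>_def mult.assoc)
    then have \<tau>: "0 < \<tau>" "\<tau> \<le> e"
      using \<beta> inv[of k] by (simp_all add: \<tau>_def)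
    have "\<not> (\<tau> \<in> {0..1} \<and> armijo (\<alpha> k) (p k) \<tau>)"
      using not_less_Least[of l "\<lambda>l. \<beta> ^ l * \<theta> k \<in> {0..1} \<and> armijo (\<alpha> k) (p k) (\<beta> ^ l * \<theta> k)"] Suc
      unfolding L[symmetric] \<tau>_def by simp
    then show ?thesis
      using arm_e[OF that(1) \<tau>] \<tau> e by simp
  qed
  \<comment> \<open>\<open>A * sqrt t\<close> is the sum over i >= 1 of sqrt K * sqrt (\<beta>^i *
    t), the bound on the length of all backward moves starting from a step t.\<close>
  define A where "A = sqrt K * sqrt \<beta> / (1 - sqrt \<beta>)"
  have sqrt\<beta>: "sqrt \<beta> < 1"
    using \<beta> by simp
  then have A: "sqrt K * sqrt \<beta> + A * sqrt \<beta> = A"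
    by (simp add: A_def field_simps)
  have "K \<ge> 0"
    using alpha rho m[OF p0] by (simp add: K_def)
  then have A0: "A \<ge> 0"
    using sqrt\<beta> \<beta> by (simp add: A_def)
  \<comment> \<open>At index 0 a first trial would give \<open>s 0 = \<theta> 0\<close>, which the
    third conjunct forbids. Otherwise all three conjuncts pass to the preceding index, the first
    because the growth of the distance is paid for by the drop in
    \<open>A * sqrt (s k)\<close>.\<close>
  have no_small_step: "\<not> (hyp_dist \<kappa> pbar (p k) + A * sqrt (s k) < e \<and> s k < \<beta> * e \<and> s k < \<theta> 0)" for k
  proof (induction k)
    case 0
    have "hyp_dist \<kappa> pbar (p 0) \<le> hyp_dist \<kappa> pbar (p 0) + A * sqrt (s 0)"
      using A0 s(1)[of 0] by simp
    then show ?case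
      using first_trial[of 0] by force
  next
    case (Suc k)
    show ?case
    proof
      assume *: "hyp_dist \<kappa> pbar (p (Suc k)) + A * sqrt (s (Suc k)) < e \<and> s (Suc k) < \<beta> * e \<and> s (Suc k) < \<theta> 0"
      have "hyp_dist \<kappa> pbar (p (Suc k)) \<le> hyp_dist \<kappa> pbar (p (Suc k)) + A * sqrt (s (Suc k))"
        using A0 s(1)[of "Suc k"] by simp
      then have "s (Suc k) = \<theta> (Suc k)"
        using first_trial * by force
      then have sk: "s k = \<beta> * s (Suc k)"
        using \<beta> by (simp add: \<theta>_s)
      then have "s k \<le> s (Suc k)"
        using \<beta> s(1)[of "Suc k"] by (simp add: mult_le_cancel_right1)
      moreover have "hyp_dist \<kappa> pbar (p k) \<le> hyp_dist \<kappa> pbar (p (Suc k)) + sqrt K * sqrt (s k)"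
        using hyp_dist_triangle[OF CH[OF pbar] pH[of "Suc k"] pH[of k]] displacement[of k]
        by (simp add: hyp_dist_commute[of "p (Suc k)"])
      moreover have "sqrt K * sqrt (s k) + A * sqrt (s k) = A * sqrt (s (Suc k))"
        using arg_cong[OF A, of "\<lambda>c. c * sqrt (s (Suc k))"]
        by (simp add: sk real_sqrt_mult algebra_simps)
      ultimately show False
        using * Suc.IH by force
    qed
  qed
  obtain r where r: "strict_mono r" and pr: "(\<lambda>j. p (r j)) \<longlonglongrightarrow> pbar"
    using cluster by (auto simp: cluster_point_def o_def)
  have dist0: "(\<lambda>j. hyp_dist \<kappa> pbar (p (r j))) \<longlonglongrightarrow> 0"
    by (intro hyp_dist_tendsto_0 pH CH pbar pr)
  obtain l where l: "(\<lambda>k. f (p k)) \<longlonglongrightarrow> l"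
    using decseq_convergent[OF dec, of m] m[OF pC] by blast
  have "(\<lambda>k. (f (p k) - f (p (Suc k))) / (\<rho> * e)) \<longlonglongrightarrow> (l - l) / (\<rho> * e)"
    using rho(1) e(1) by (intro tendsto_intros l LIMSEQ_Suc[OF l]) auto
  then have bound0: "(\<lambda>j. (f (p (r j)) - f (p (Suc (r j)))) / (\<rho> * e)) \<longlonglongrightarrow> 0"
    using LIMSEQ_subseq_LIMSEQ[OF _ r] by (fastforce simp: o_def)
  \<comment> \<open>Near \<open>pbar\<close> each step costs at least \<rho> * e *
    \<open>s k\<close> of the objective, whose successive decreases vanish because its values
    converge.\<close>
  have s0: "(\<lambda>j. s (r j)) \<longlonglongrightarrow> 0"
  proof (rule tendsto_sandwich[OF _ _ tendsto_const bound0])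
    show "\<forall>\<^sub>F j in sequentially. 0 \<le> s (r j)"
      using s(1) by (auto intro!: always_eventually less_imp_le)
    show "\<forall>\<^sub>F j in sequentially. s (r j) \<le> (f (p (r j)) - f (p (Suc (r j)))) / (\<rho> * e)"
      using order_tendstoD(2)[OF dist0 e(1)]
    proof eventually_elim
      case (elim j)
      have "s (r j) * (\<rho> * e) \<le> \<rho> * (s (r j) * D (r j))"
        using De[OF elim] s(1)[of "r j"] rho(1) by simp
      also have "\<dots> \<le> f (p (r j)) - f (p (Suc (r j)))"
        by (rule decrease)
      finally show ?case
        using rho(1) e(1) by (simp add: pos_le_divide_eq)
    qed
  qed
  have "(\<lambda>j. hyp_dist \<kappa> pbar (p (r j)) + A * sqrt (s (r j))) \<longlonglongrightarrow> 0 + A * sqrt 0"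
    by (intro tendsto_intros dist0 s0)
  then have "\<forall>\<^sub>F j in sequentially. hyp_dist \<kappa> pbar (p (r j)) + A * sqrt (s (r j)) < e"
    by (rule order_tendstoD) (simp add: e)
  moreover have "\<forall>\<^sub>F j in sequentially. s (r j) < \<beta> * e"
    using s0 by (rule order_tendstoD) (simp add: e \<beta>)
  moreover have "\<forall>\<^sub>F j in sequentially. s (r j) < \<theta> 0"
    using s0 by (rule order_tendstoD) (rule \<theta>0)
  ultimately have "\<forall>\<^sub>F j in sequentially. False"
    by eventually_elim (use no_small_step in blast)
  then show False
    by simp
qed

end

theorem theorem21:
  fixes \<kappa> \<rho> \<beta> \<theta>0 \<alpha>lo \<alpha>hi :: real
    and C :: "((real^'n) \<times> real) set"
    and f :: "(real^'n) \<times> real \<Rightarrow> real"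
    and p y z :: "nat \<Rightarrow> (real^'n) \<times> real"
    and \<alpha> \<theta> :: "nat \<Rightarrow> real"
    and L :: "nat \<Rightarrow> nat"
    and pbar :: "(real^'n) \<times> real"
  assumes "\<kappa> > 0"
    and "C \<subseteq> hyp_space \<kappa>" and "closed C" and "hyp_convex \<kappa> C"
    and "f differentiable_on hyp_space \<kappa>"
    and "continuous_on (hyp_space \<kappa>) (hyp_grad \<kappa> f)"
    and "{q \<in> C. \<forall>q'\<in>C. f q \<le> f q'} \<noteq> {}" and "bdd_below (f ` C)"
    and "0 < \<rho>" and "\<rho> < 1" and "0 < \<beta>" and "\<beta> < 1" and "0 < \<theta>0" and "\<theta>0 < 1"
    and "0 < \<alpha>lo" and "0 < \<alpha>hi"
    and "gradient_projection_backtracking \<kappa> f C \<rho> \<beta> \<theta>0 \<alpha>lo \<alpha>hi \<alpha> \<theta> L y z p"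
    and "\<forall>k. hyp_grad \<kappa> f (p k) \<noteq> 0"
    and "pbar \<in> C" and "cluster_point p pbar"
  shows "hyp_stationary \<kappa> f C pbar"
proof -
  interpret gradient_projection \<kappa> C f \<rho> \<alpha>lo \<alpha>hi
    using assms by unfold_locales
  \<comment> \<open>The gradient vanishes at no iterate, so the guarded clauses of the method hold
    at every index.\<close>
  have run: "p 0 \<in> C" "\<theta> 0 = \<theta>0"
    "\<And>k. \<alpha>lo \<le> \<alpha> k" "\<And>k. \<alpha> k \<le> \<alpha>hi"
    "\<And>k. y k = hyp_exp \<kappa> (p k) (- \<alpha> k *\<^sub>R hyp_grad \<kappa> f (p k))"
    "\<And>k. z k = hyp_proj \<kappa> C (y k)"
    "\<And>k. L k = (LEAST l. \<beta> ^ l * \<theta> k \<in> {0..1} \<and>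
       f (hyp_geodesic \<kappa> (p k) (z k) (\<beta> ^ l * \<theta> k))
         \<le> f (p k) + \<rho> * (\<beta> ^ l * \<theta> k) * lorentz (hyp_grad \<kappa> f (p k)) (hyp_log \<kappa> (p k) (z k)))"
    "\<And>k. p (Suc k) = hyp_geodesic \<kappa> (p k) (z k) (\<beta> ^ L k * \<theta> k)"
    "\<And>k. \<theta> (Suc k) = \<beta> powi (int (L k) - 1) * \<theta> k"
    using assms(17,18) unfolding gradient_projection_backtracking_def by blast+
  have log: "hyp_log \<kappa> (p k) (z k) = direction (\<alpha> k) (p k)" for k
    by (simp add: direction_def run(5,6))
  show ?thesis
  proof (rule cluster_point_stationary[where p = p and \<theta> = \<theta> and \<alpha> = \<alpha> and L = L and \<beta> = \<beta>])
    show "0 < \<theta> 0"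
      using run(2) assms(13) by simp
    show "L k = (LEAST l. \<beta> ^ l * \<theta> k \<in> {0..1} \<and> armijo (\<alpha> k) (p k) (\<beta> ^ l * \<theta> k))" for k
      unfolding armijo_def using run(7)[of k] unfolding hyp_geodesic_def log .
    show "p (Suc k) = hyp_exp \<kappa> (p k) ((\<beta> ^ L k * \<theta> k) *\<^sub>R direction (\<alpha> k) (p k))" for k
      using run(8)[of k] unfolding hyp_geodesic_def log .
  qed (fact assms run)+
qed

end
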